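(* Suppose $\mathrm{supp}(\mathbb{P}^* )\subseteq\{\mathbf{a}_0,\dots,\mathbf{a}_{n-1}\}\subset\mathbb{R}^d$. For each of the two families $\{\mathcal{U}^{\chi^2}_\epsilon:0<\epsilon<1\}$ and $\{\mathcal{U}^{G}_\epsilon:0<\epsilon<1\}$, with probability (at least) $1-\alpha$ over the sample the family simultaneously implies a probabilistic guarantee for $\mathbb{P}^*$, where $$\mathcal{U}_\epsilon^{\chi^2}=\Big\{\mathbf{u}\in\mathbb{R}^d:\mathbf{u}=\sum_{j=0}^{n-1}q_j\mathbf{a}_j,\ \mathbf{q}\in\Delta_n,\ \mathbf{q}\le\tfrac1\epsilon\mathbf{p},\ \mathbf{p}\in\mathcal{P}^{\chi^2}\Big\},$$ $$\mathcal{U}_\epsilon^{G}=\Big\{\mathbf{u}\in\mathbb{R}^d:\mathbf{u}=\sum_{j=0}^{n-1}q_j\mathbf{a}_j,\ \mathbf{q}\in\Delta_n,\ \mathbf{q}\le\tfrac1\epsilon\mathbf{p},\ \mathbf{p}\in\mathcal{P}^{G}\Big\}.$$ Their support functions are given by $$\delta^*(\mathbf{v}\mid\mathcal{U}^{\chi^2}_\epsilon)=\min_{\mathbf{w},\mathbf{s}\in\mathbb{R}^n,\ \beta,\eta,\lambda\in\mathbb{R}}\ \beta+\frac1\epsilon\Big(\eta+\frac{\lambda\chi^2_{n-1,1-\alpha}}{N}+2\lambda-2\sum_{i=0}^{n-1}\hat p_is_i\Big)$$ subject to $\mathbf{0}\le\mathbf{w}\le(\lambda+\eta)\mathbf{e}$,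 $\lambda\ge0$, $\mathbf{s}\ge\mathbf{0}$, $\left\|\begin{pmatrix}2s_i\\ w_i-\eta\end{pmatrix}\right\|\le2\lambda-w_i+\eta$ and $\mathbf{a}_i^T\mathbf{v}-w_i\le\beta$ for $i=0,\dots,n-1$; and $$\delta^*(\mathbf{v}\mid\mathcal{U}^{G}_\epsilon)=\min_{\mathbf{w}\in\mathbb{R}^n,\ \beta,\eta,\lambda\in\mathbb{R}}\ \beta+\frac1\epsilon\Big(\eta+\frac{\lambda\chi^2_{n-1,1-\alpha}}{2N}-\lambda\sum_{i=0}^{n-1}\hat p_i\log\Big(1-\frac{w_i-\eta}{\lambda}\Big)\Big)$$ subject to $\mathbf{0}\le\mathbf{w}\le(\lambda+\eta)\mathbf{e}$, $\lambda\ge0$, and $\mathbf{a}_i^T\mathbf{v}-w_i\le\beta$ for $i=0,\dots,n-1$.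
   Context: $0<\alpha<1$; $\mathcal{S}=\{\hat{\mathbf{u}}^1,\dots,\hat{\mathbf{u}}^N\}$ is drawn i.i.d. from the unknown measure $\mathbb{P}^*$ on $\mathbb{R}^d$; $\tilde{\mathbf{u}}$ is a random vector. $\Delta_n=\{\mathbf{p}=(p_0,\dots,p_{n-1})^T:\mathbf{e}^T\mathbf{p}=1,\ p_i\ge0\}$, $\mathbf{e}$ is the all-ones vector, vector inequalities are componentwise. $\hat p_i=\frac1N\sum_{j=1}^N\mathbb{I}(\hat{\mathbf{u}}^j=\mathbf{a}_i)$. $\chi^2_{n-1,1-\alpha}$ is the $1-\alpha$ quantile of the $\chi^2$ distribution with $n-1$ degrees of freedom. $D(\mathbf{p},\mathbf{q})=\sum_ip_i\log(p_i/q_i)$ is relative entropy. The confidence regions of Pearson's $\chi^2$ test and of the $G$ test are $$\mathcal{P}^{\chi^2}=\Big\{\mathbf{p}\in\Delta_n:\sum_{i=0}^{n-1}\frac{(p_i-\hat p_i)^2}{2p_i}\le\frac1{2N}\chi^2_{n-1,1-\alpha}\Big\},\qquad\mathcal{P}^{G}=\Big\{\mathbf{p}\in\Delta_n:D(\hat{\mathbf{p}},\mathbf{p})\le\frac1{2N}\chi^2_{n-1,1-\alpha}\Big\},$$ a vector $\mathbf{p}$ being identified with the measure $\mathbb{P}(\tilde{\mathbf{u}}=\mathbf{a}_i)=p_i$. Conventions: $0/0=0$, $c/0=+\infty$ for $c>0$, $0\log(0/q)=0$, and terms at $\lambda=0$ (or with $\log 0$) are read by lower semicontinuous extension (so $0\cdot\log(1-(w_i-\eta)/0)=0$,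 and terms with $\hat p_i=0$ vanish). Standing assumption: each test is valid at level $\alpha$, i.e. $\mathbb{P}^*$ belongs to $\mathcal{P}^{\chi^2}$ (respectively to $\mathcal{P}^G$) with probability at least $1-\alpha$ with respect to the sampling. $\delta^*(\mathbf{v}\mid\mathcal{U})=\sup_{\mathbf{u}\in\mathcal{U}}\mathbf{v}^T\mathbf{u}$. A set $\mathcal{U}$ implies a probabilistic guarantee for $\mathbb{P}^*$ at level $\epsilon$ if for every $\mathbf{x}^*\in\mathbb{R}^k$ and every real-valued $f(\mathbf{u},\mathbf{x})$ concave in $\mathbf{u}$ for all $\mathbf{x}$: $f(\mathbf{u},\mathbf{x}^* )\le0\ \forall\mathbf{u}\in\mathcal{U}$ implies $\mathbb{P}^*(f(\tilde{\mathbf{u}},\mathbf{x}^* )\le0)\ge1-\epsilon$. A family $\{\mathcal{U}_\epsilon:0<\epsilon<1\}$ simultaneously implies a probabilistic guarantee for $\mathbb{P}^*$ if for every $0<\epsilon<1$ the set $\mathcal{U}_\epsilon$ implies one at level $\epsilon$. *)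

theory Defs
  imports "HOL-Probability.Probability"
begin

section \<open>The chi-squared distribution and quantiles\<close>

text \<open>Law of the sum of squares of \<open>k\<close> independent standard normal variables; for
  \<open>k = 0\<close> this is the point mass at \<open>0\<close>.\<close>

definition chi_square_distribution :: "nat \<Rightarrow> real measure" where
  "chi_square_distribution k =
     distr (Pi\<^sub>M {..<k} (\<lambda>_. std_normal_distribution)) borel (\<lambda>x. \<Sum>i<k. (x i)\<^sup>2)"

definition quantile :: "real measure \<Rightarrow> real \<Rightarrow> real" where
  "quantile M p = Inf {x. p \<le> cdf M x}"

definition chi_square_quantile :: "nat \<Rightarrow> real \<Rightarrow> real" where
  "chi_square_quantile k p = quantile (chi_square_distribution k) p"

section \<open>Support of a measure, simplex, empirical frequencies\<close>

definition measure_support :: "'a::topological_space measure \<Rightarrow> 'a set" where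
  "measure_support M = {x. \<forall>V. open V \<longrightarrow> x \<in> V \<longrightarrow> 0 < emeasure M V}"

text \<open>The index set \<open>{0,...,n-1}\<close> is rendered by a finite type \<open>'n\<close> with
  \<open>n = CARD('n)\<close>. The order on vectors is the componentwise one.\<close>

definition prob_simplex :: "(real^'n) set" where
  "prob_simplex = {p. (\<Sum>i\<in>UNIV. p $ i) = 1 \<and> 0 \<le> p}"

definition empirical :: "('n::finite \<Rightarrow> 'b) \<Rightarrow> nat \<Rightarrow> (nat \<Rightarrow> 'b) \<Rightarrow> real^'n" where
  "empirical a N u = (\<chi> i. (1 / real N) * (\<Sum>j<N. of_bool (u j = a i)))"

section \<open>Confidence regions\<close>

text \<open>The terms are extended-real-valued because HOL division by \<open>0\<close> would give \<open>0\<close>, whereas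
  \<open>c/0 = \<infinity>\<close> for \<open>c > 0\<close> is intended; a term whose numerator also vanishes is \<open>0\<close>.\<close>

definition pearson_term :: "real \<Rightarrow> real \<Rightarrow> ereal" where
  "pearson_term ph p =
     (if p = 0 then (if ph = 0 then 0 else \<infinity>) else ereal ((p - ph)\<^sup>2 / (2 * p)))"

definition rel_entropy_term :: "real \<Rightarrow> real \<Rightarrow> ereal" where
  "rel_entropy_term p q =
     (if p = 0 then 0 else if q = 0 then \<infinity> else ereal (p * ln (p / q)))"

definition rel_entropy :: "real^'n \<Rightarrow> real^'n \<Rightarrow> ereal" where
  "rel_entropy p q = (\<Sum>i\<in>UNIV. rel_entropy_term (p $ i) (q $ i))"

definition conf_region_chi :: "real \<Rightarrow> nat \<Rightarrow> real^'n \<Rightarrow> (real^'n) set" where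
  "conf_region_chi \<alpha> N ph =
     {p \<in> prob_simplex. (\<Sum>i\<in>UNIV. pearson_term (ph $ i) (p $ i))
        \<le> ereal (1 / (2 * real N) * chi_square_quantile (CARD('n) - 1) (1 - \<alpha>))}"

definition conf_region_G :: "real \<Rightarrow> nat \<Rightarrow> real^'n \<Rightarrow> (real^'n) set" where
  "conf_region_G \<alpha> N ph =
     {p \<in> prob_simplex. rel_entropy ph p
        \<le> ereal (1 / (2 * real N) * chi_square_quantile (CARD('n) - 1) (1 - \<alpha>))}"

section \<open>Uncertainty sets, support functions, probabilistic guarantees\<close>

definition uncertainty_set ::
    "('n::finite \<Rightarrow> 'b::real_vector) \<Rightarrow> (real^'n) set \<Rightarrow> real \<Rightarrow> 'b set" where
  "uncertainty_set a R \<epsilon> =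
     {u. \<exists>q p. u = (\<Sum>j\<in>UNIV. (q $ j) *\<^sub>R a j) \<and> q \<in> prob_simplex
               \<and> q \<le> (1 / \<epsilon>) *\<^sub>R p \<and> p \<in> R}"

definition support_fun :: "'b::real_inner set \<Rightarrow> 'b \<Rightarrow> ereal" where
  "support_fun U v = (SUP u\<in>U. ereal (v \<bullet> u))"

text \<open>The type argument carries the dimension of the decision variable \<open>x\<close>.\<close>

definition implies_guarantee ::
    "'k::finite itself \<Rightarrow> (real^'d) measure \<Rightarrow> (real^'d) set \<Rightarrow> real \<Rightarrow> bool" where
  "implies_guarantee _ P U \<epsilon> \<longleftrightarrow>
     (\<forall>(x0 :: real^'k) (f :: real^'d \<Rightarrow> real^'k \<Rightarrow> real).
        (\<forall>x. concave_on UNIV (\<lambda>u. f u x)) \<longrightarrow>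
        (\<forall>u\<in>U. f u x0 \<le> 0) \<longrightarrow>
        measure P {u \<in> space P. f u x0 \<le> 0} \<ge> 1 - \<epsilon>)"

definition simultaneously_implies_guarantee ::
    "'k::finite itself \<Rightarrow> (real^'d) measure \<Rightarrow> (real \<Rightarrow> (real^'d) set) \<Rightarrow> bool" where
  "simultaneously_implies_guarantee k P \<U> \<longleftrightarrow>
     (\<forall>\<epsilon>. 0 < \<epsilon> \<and> \<epsilon> < 1 \<longrightarrow> implies_guarantee k P (\<U> \<epsilon>) \<epsilon>)"

section \<open>The minimization problems\<close>

definition is_minimum :: "('a \<Rightarrow> ereal) \<Rightarrow> 'a set \<Rightarrow> ereal \<Rightarrow> bool" where
  "is_minimum f F m \<longleftrightarrow> (\<exists>x\<in>F. f x = m) \<and> (\<forall>x\<in>F. m \<le> f x)"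

definition chi_feasible ::
    "('n::finite \<Rightarrow> 'b::real_inner) \<Rightarrow> 'b
       \<Rightarrow> ((real^'n) \<times> (real^'n) \<times> real \<times> real \<times> real) set" where
  "chi_feasible a v =
     {(w, s, \<beta>, \<eta>, l). 0 \<le> w \<and> w \<le> (\<chi> i. l + \<eta>) \<and> 0 \<le> l \<and> 0 \<le> s \<and>
        (\<forall>i. norm (2 * s $ i, w $ i - \<eta>) \<le> 2 * l - w $ i + \<eta> \<and> a i \<bullet> v - w $ i \<le> \<beta>)}"

definition chi_objective ::
    "real \<Rightarrow> nat \<Rightarrow> real^'n \<Rightarrow> real
       \<Rightarrow> ((real^'n) \<times> (real^'n) \<times> real \<times> real \<times> real) \<Rightarrow> ereal" where
  "chi_objective \<alpha> N ph \<epsilon> = (\<lambda>(w, s, \<beta>, \<eta>, l).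
     ereal (\<beta> + 1 / \<epsilon> *
       (\<eta> + l * chi_square_quantile (CARD('n) - 1) (1 - \<alpha>) / real N + 2 * l
          - 2 * (\<Sum>i\<in>UNIV. ph $ i * s $ i))))"

definition G_feasible ::
    "('n::finite \<Rightarrow> 'b::real_inner) \<Rightarrow> 'b \<Rightarrow> ((real^'n) \<times> real \<times> real \<times> real) set" where
  "G_feasible a v =
     {(w, \<beta>, \<eta>, l). 0 \<le> w \<and> w \<le> (\<chi> i. l + \<eta>) \<and> 0 \<le> l \<and>
        (\<forall>i. a i \<bullet> v - w $ i \<le> \<beta>)}"

text \<open>\<open>G_term l c t\<close> is \<open>- l * c * log (1 - t / l)\<close> for \<open>c, l \<ge> 0\<close> and \<open>t \<le> l\<close>, extended lower
  semicontinuously: \<open>0\<close> for \<open>l = 0\<close> or \<open>c = 0\<close>, and \<open>\<infinity>\<close> for \<open>log 0\<close> (that is, \<open>t = l\<close>) with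
  \<open>c, l > 0\<close>. (HOL's \<open>ln 0 = 0\<close> would be wrong here.)\<close>

definition G_term :: "real \<Rightarrow> real \<Rightarrow> real \<Rightarrow> ereal" where
  "G_term l c t =
     (if l = 0 \<or> c = 0 then 0
      else if t < l then ereal (- l * c * ln (1 - t / l)) else \<infinity>)"

definition G_objective ::
    "real \<Rightarrow> nat \<Rightarrow> real^'n \<Rightarrow> real \<Rightarrow> ((real^'n) \<times> real \<times> real \<times> real) \<Rightarrow> ereal" where
  "G_objective \<alpha> N ph \<epsilon> = (\<lambda>(w, \<beta>, \<eta>, l).
     ereal \<beta> + ereal (1 / \<epsilon>) *
       (ereal (\<eta> + l * chi_square_quantile (CARD('n) - 1) (1 - \<alpha>) / (2 * real N))
          + (\<Sum>i\<in>UNIV. G_term l (ph $ i) (w $ i - \<eta>))))"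

end

theory Submission
  imports Defs
begin

text \<open>
  The probabilistic guarantee rests on one observation: the law of the data conditioned on the event
  \<open>f > 0\<close> of a violated constraint has density at most \<open>1 / \<epsilon>\<close> with respect to the true law as soon as
  that event has probability above \<open>\<epsilon>\<close>. Its mean then lies in the uncertainty set, provided that the true
  law lies in the confidence region, and Jensen's inequality contradicts \<open>f \<le> 0\<close> there
  (\<open>guarantee_of_mem_region\<close>). The argument covers all \<open>\<epsilon>\<close> at once, so the event that the family
  implies the guarantees contains the event that the true law lies in the region. It is measurable
  because the sample enters through finitely many empirical frequencies
  (\<open>empirical_event_measurable\<close>).

  The formulas for the support functions are Lagrangian duality for the convex problem of maximizing
  \<open>\<Sum>q\<^sub>i (a\<^sub>i \<bullet> v)\<close> over \<open>q, p\<close> in the simplex with \<open>q \<le> p / \<epsilon>\<close> and a divergence of \<open>p\<close> bounded by the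
  quantile. The multiplier \<open>w\<close> belongs to \<open>q \<le> p / \<epsilon>\<close>, \<open>\<beta>\<close> and \<open>\<eta>\<close> to the two normalizations, and
  \<open>l\<close> to the divergence. Weak duality is elementary: the inequality of the means for Pearson's
  divergence (\<open>chi_young\<close>), and \<open>ln x \<le> x - 1\<close> for the relative entropy (\<open>G_young\<close>). For
  strong duality with attainment, a hyperplane separating \<open>0\<close> from the achievable slacks supplies
  multipliers (\<open>lagrange_multipliers\<close>). The remaining supremum over \<open>p\<close> splits into problems in one
  variable, whose values are the terms of the stated objectives (\<open>chi_conjugate\<close>,
  \<open>G_conjugate\<close>). The constraint qualification needs a positive quantile, which holds for \<open>n > 1\<close>
  (\<open>chi_square_quantile_pos\<close>); the case \<open>n = 1\<close> is trivial.
\<close>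

section \<open>Positivity of the chi-squared quantile\<close>

lemma std_normal_prod_prob_space:
  "prob_space (Pi\<^sub>M {..<k::nat} (\<lambda>_. std_normal_distribution))"
  by (intro prob_space_PiM) (simp add: prob_space_normal_density)

lemma real_distribution_chi_square: "real_distribution (chi_square_distribution k)"
  unfolding chi_square_distribution_def
  by (intro prob_space.real_distribution_distr std_normal_prod_prob_space) measurable

lemma cdf_chi_square:
  "cdf (chi_square_distribution k) x =
     measure (Pi\<^sub>M {..<k} (\<lambda>_. std_normal_distribution))
       ((\<lambda>y. \<Sum>i<k. (y i)\<^sup>2) -` {..x} \<inter> space (Pi\<^sub>M {..<k} (\<lambda>_. std_normal_distribution)))"
  unfolding chi_square_distribution_def cdf_def
  by (subst measure_distr) auto

lemma cdf_chi_square_neg: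
  assumes "x < 0"
  shows "cdf (chi_square_distribution k) x = 0"
proof -
  have *: "x < (\<Sum>i<k. (y i)\<^sup>2)" for y :: "nat \<Rightarrow> real"
    using assms by (intro less_le_trans[OF assms] sum_nonneg) auto
  have "(\<lambda>y. \<Sum>i<k. (y i)\<^sup>2) -` {..x} = ({} :: (nat \<Rightarrow> real) set)"
  proof (rule equals0I)
    fix y :: "nat \<Rightarrow> real" assume "y \<in> (\<lambda>y. \<Sum>i<k. (y i)\<^sup>2) -` {..x}"
    with *[of y] show False by simp
  qed
  then show ?thesis by (simp add: cdf_chi_square)
qed

text \<open>A vanishing sum of squares forces the first coordinate to vanish, a null event because the
  normal distribution has a density.\<close>

lemma cdf_chi_square_0:
  assumes "0 < k"
  shows "cdf (chi_square_distribution k) 0 = 0"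
proof -
  let ?M = "Pi\<^sub>M {..<k} (\<lambda>_. std_normal_distribution)"
  interpret prob_space ?M by (rule std_normal_prod_prob_space)
  have "cdf (chi_square_distribution k) 0 \<le> measure ?M ((\<lambda>y. y 0) -` {0} \<inter> space ?M)"
    unfolding cdf_chi_square
  proof (rule finite_measure_mono)
    show "(\<lambda>y. \<Sum>i<k. (y i)\<^sup>2) -` {..0} \<inter> space ?M \<subseteq> (\<lambda>y. y 0) -` {0} \<inter> space ?M"
    proof
      fix y assume y: "y \<in> (\<lambda>y. \<Sum>i<k. (y i)\<^sup>2) -` {..0} \<inter> space ?M"
      then have "(\<Sum>i<k. (y i)\<^sup>2) = 0" by (intro antisym sum_nonneg) auto
      then have "\<forall>i\<in>{..<k}. (y i)\<^sup>2 = 0" by (subst (asm) sum_nonneg_eq_0_iff) auto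
      with assms y show "y \<in> (\<lambda>y. y 0) -` {0} \<inter> space ?M" by auto
    qed
    show "(\<lambda>y. y 0) -` {0} \<inter> space ?M \<in> sets ?M"
      using assms by (intro measurable_sets[of _ _ std_normal_distribution]) auto
  qed
  also have "\<dots> = measure (distr ?M std_normal_distribution (\<lambda>y. y 0)) {0}"
    using assms by (subst measure_distr) auto
  also have "distr ?M std_normal_distribution (\<lambda>y. y 0) = std_normal_distribution"
    using assms by (intro distr_PiM_component) (auto simp: prob_space_normal_density)
  also have "measure std_normal_distribution {0} = 0"
  proof -
    have "emeasure std_normal_distribution {0} = 0"
      using AE_lborel_singleton[of "0::real"]
      by (subst emeasure_density) (auto simp: nn_integral_0_iff_AE indicator_def)
    then show ?thesis by (simp add: measure_def)
  qed
  finally show ?thesis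
    using real_distribution_chi_square[of k]
    by (metis antisym cdf_def measure_nonneg)
qed

lemma quantile_ge_of_cdf_less:
  assumes D: "real_distribution D" and "p < 1" and less: "cdf D x < p"
  shows "x \<le> quantile D p"
  unfolding quantile_def
proof (rule cInf_greatest)
  interpret real_distribution D by fact
  have "eventually (\<lambda>y. p < cdf D y) at_top"
    using cdf_lim_at_top_prob \<open>p < 1\<close> by (rule order_tendstoD)
  then obtain y where "p < cdf D y"
    by (metis eventually_happens trivial_limit_at_top_linorder)
  then show "{x. p \<le> cdf D x} \<noteq> {}" by (auto intro: less_imp_le)
  fix y assume "y \<in> {x. p \<le> cdf D x}"
  then show "x \<le> y"
    using less cdf_nondecreasing[of y x] by (cases "y \<le> x") auto
qed

lemma chi_square_quantile_nonneg:
  assumes "0 < p" "p < 1"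
  shows "0 \<le> chi_square_quantile k p"
  unfolding chi_square_quantile_def
proof (rule dense_le)
  fix x :: real assume "x < 0"
  then show "x \<le> quantile (chi_square_distribution k) p"
    using assms by (intro quantile_ge_of_cdf_less real_distribution_chi_square)
      (simp_all add: cdf_chi_square_neg)
qed

text \<open>With at least one degree of freedom the distribution has no atom at \<open>0\<close>, so by right
  continuity its distribution function stays below \<open>p\<close> slightly beyond \<open>0\<close>. This strict
  positivity is what gives the confidence regions an interior point.\<close>

lemma chi_square_quantile_pos:
  assumes "0 < p" "p < 1" "0 < k"
  shows "0 < chi_square_quantile k p"
proof -
  interpret real_distribution "chi_square_distribution k" by (rule real_distribution_chi_square)
  have "continuous (at_right 0) (cdf (chi_square_distribution k))"
    by (rule cdf_is_right_cont)
  then have "(cdf (chi_square_distribution k) \<longlongrightarrow> 0) (at_right 0)"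
    using cdf_chi_square_0[OF \<open>0 < k\<close>] by (simp add: continuous_within)
  then have "eventually (\<lambda>x. cdf (chi_square_distribution k) x < p) (at_right 0)"
    using \<open>0 < p\<close> by (rule order_tendstoD)
  then obtain b where "0 < b" and b: "\<And>x. 0 < x \<Longrightarrow> x < b \<Longrightarrow> cdf (chi_square_distribution k) x < p"
    by (auto simp: eventually_at_right_field)
  have "b / 2 \<le> chi_square_quantile k p"
    unfolding chi_square_quantile_def using \<open>0 < b\<close> \<open>p < 1\<close>
    by (intro quantile_ge_of_cdf_less real_distribution_chi_square b) auto
  with \<open>0 < b\<close> show ?thesis by simp
qed

section \<open>Lagrange multipliers for the support function\<close>

lemma slope_nonpos:
  fixes k C z0 :: real
  assumes "\<And>z. z \<le> z0 \<Longrightarrow> 0 \<le> k * z + C"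
  shows "k \<le> 0"
proof (rule ccontr)
  assume "\<not> k \<le> 0"
  then have "0 < k" by simp
  have "k * min z0 (- (C + 1) / k) \<le> k * (- (C + 1) / k)"
    using \<open>0 < k\<close> by (intro mult_left_mono) auto
  also have "\<dots> = - (C + 1)" using \<open>0 < k\<close> by simp
  finally show False using assms[of "min z0 (- (C + 1) / k)"] by simp
qed

text \<open>Duality is proved with strictly positive \<open>p\<close> only, where both divergences are finite and
  given by their formulas. Since the constraint qualification holds at such a point, this smaller
  primal problem already yields optimal multipliers.\<close>

definition pos_orthant :: "(real^'n) set" where
  "pos_orthant = {p. \<forall>i. 0 < p $ i}"

lemma convex_pos_orthant: "convex pos_orthant"
  unfolding pos_orthant_def convex_def
proof clarify
  fix p q :: "real^'n" and u v :: real and i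
  assume "\<forall>i. 0 < p $ i" "\<forall>i. 0 < q $ i" "0 \<le> u" "0 \<le> v" "u + v = 1"
  then show "0 < (u *\<^sub>R p + v *\<^sub>R q) $ i"
    by (cases "u = 0") (auto intro!: add_pos_nonneg mult_nonneg_nonneg less_imp_le[of 0 "q $ i"])
qed

lemma inner_nonneg_vec:
  fixes x y :: "real^'n"
  assumes "0 \<le> x" "0 \<le> y"
  shows "0 \<le> x \<bullet> y"
  using assms by (auto simp: inner_vec_def less_eq_vec_def intro!: sum_nonneg)

text \<open>The set of all tuples of slacks that some \<open>(q, p)\<close> achieves: \<open>t\<close> is the excess of the objective
  over \<open>\<delta>\<close>, and \<open>y\<close>, \<open>x\<close>, \<open>A\<close>, \<open>B\<close> belong to the constraints \<open>q \<le> K p\<close>, \<open>g p \<le> r\<close>,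
  \<open>\<Sum>q = 1\<close>, \<open>\<Sum>p = 1\<close>. The strict inequality for \<open>t\<close> makes \<open>0\<close> belong to it exactly if some
  feasible point with positive \<open>p\<close> has an objective value above \<open>\<delta>\<close>.\<close>

lemma convex_slack_set:
  fixes g :: "real^'n \<Rightarrow> real" and c :: "real^'n"
  assumes g: "convex_on pos_orthant g"
  shows "convex {(t :: real, y :: real^'n, x :: real, A :: real, B :: real).
    \<exists>q p. 0 \<le> q \<and> p \<in> pos_orthant \<and> t < c \<bullet> q - \<delta> \<and> y \<le> K *\<^sub>R p - q \<and> x \<le> r - g p
      \<and> A = (\<Sum>i\<in>UNIV. q $ i) - 1 \<and> B = (\<Sum>i\<in>UNIV. p $ i) - 1}"
    (is "convex ?S")
proof (rule convexI)
  fix s1 s2 and u v :: real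
  assume s: "s1 \<in> ?S" "s2 \<in> ?S" and uv0: "0 \<le> u" "0 \<le> v" "u + v = 1"
  obtain t1 y1 x1 q1 p1 where 1: "0 \<le> q1" "p1 \<in> pos_orthant" "t1 < c \<bullet> q1 - \<delta>"
      "y1 \<le> K *\<^sub>R p1 - q1" "x1 \<le> r - g p1"
    and s1: "s1 = (t1, y1, x1, (\<Sum>i\<in>UNIV. q1 $ i) - 1, (\<Sum>i\<in>UNIV. p1 $ i) - 1)"
    using s(1) by auto
  obtain t2 y2 x2 q2 p2 where 2: "0 \<le> q2" "p2 \<in> pos_orthant" "t2 < c \<bullet> q2 - \<delta>"
      "y2 \<le> K *\<^sub>R p2 - q2" "x2 \<le> r - g p2"
    and s2: "s2 = (t2, y2, x2, (\<Sum>i\<in>UNIV. q2 $ i) - 1, (\<Sum>i\<in>UNIV. p2 $ i) - 1)"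
    using s(2) by auto
  have uv: "v = 1 - u" "u \<le> 1" using uv0 by auto
  define q where "q = u *\<^sub>R q1 + v *\<^sub>R q2"
  define p where "p = u *\<^sub>R p1 + v *\<^sub>R p2"
  have "0 \<le> q" using 1 2 uv0 by (auto simp: q_def less_eq_vec_def)
  moreover have "p \<in> pos_orthant"
    using 1 2 uv0 convex_pos_orthant unfolding p_def convex_def by blast
  moreover have "u * t1 + v * t2 < c \<bullet> q - \<delta>"
  proof -
    have "u * t1 + v * t2 < u * (c \<bullet> q1 - \<delta>) + v * (c \<bullet> q2 - \<delta>)"
    proof (cases "u = 0")
      case False
      then show ?thesis using 1 2 uv0 by (intro add_less_le_mono mult_strict_left_mono mult_left_mono) auto
    qed (use 1 2 uv0 in auto)
    also have "\<dots> = c \<bullet> q - \<delta>" unfolding q_def uv by (simp add: algebra_simps inner_simps)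
    finally show ?thesis .
  qed
  moreover have "u *\<^sub>R y1 + v *\<^sub>R y2 \<le> K *\<^sub>R p - q"
  proof -
    have "u *\<^sub>R y1 + v *\<^sub>R y2 \<le> u *\<^sub>R (K *\<^sub>R p1 - q1) + v *\<^sub>R (K *\<^sub>R p2 - q2)"
      using 1 2 uv0 by (auto simp: less_eq_vec_def intro!: add_mono mult_left_mono)
    also have "\<dots> = K *\<^sub>R p - q" unfolding q_def p_def by (simp add: algebra_simps)
    finally show ?thesis .
  qed
  moreover have "u * x1 + v * x2 \<le> r - g p"
  proof -
    have "u * x1 + v * x2 \<le> u * (r - g p1) + v * (r - g p2)"
      using 1 2 uv0 by (intro add_mono mult_left_mono) auto
    moreover have "g p \<le> u * g p1 + v * g p2"
      unfolding p_def using 1 2 uv0 g by (auto simp: convex_on_def)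
    ultimately show ?thesis unfolding uv by (simp add: algebra_simps)
  qed
  moreover have "u * ((\<Sum>i\<in>UNIV. q1 $ i) - 1) + v * ((\<Sum>i\<in>UNIV. q2 $ i) - 1) = (\<Sum>i\<in>UNIV. q $ i) - 1"
    unfolding q_def uv by (simp add: sum.distrib sum_distrib_left[symmetric]) (simp add: algebra_simps)
  moreover have "u * ((\<Sum>i\<in>UNIV. p1 $ i) - 1) + v * ((\<Sum>i\<in>UNIV. p2 $ i) - 1) = (\<Sum>i\<in>UNIV. p $ i) - 1"
    unfolding p_def uv by (simp add: sum.distrib sum_distrib_left[symmetric]) (simp add: algebra_simps)
  ultimately show "u *\<^sub>R s1 + v *\<^sub>R s2 \<in> ?S"
    unfolding s1 s2 by (simp, intro exI[of _ q] conjI exI[of _ p]) auto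
qed

text \<open>Since \<open>\<delta>\<close> is an upper bound of the primal problem, \<open>0\<close> lies outside the convex set of achievable
  slacks, and a hyperplane separates the two. Its coefficients are the multipliers, once the
  coefficient \<open>k1\<close> of the objective is known to be nonzero. This is where the interior point
  \<open>p0\<close> enters: with \<open>k1 = 0\<close> and \<open>q = p = p0\<close> all inequality constraints are strict, so their
  coefficients vanish, and rescaling \<open>p0\<close> then kills those of the two equations.
  The multipliers attain the bound \<open>\<delta>\<close> itself.\<close>

lemma lagrange_multipliers:
  fixes g :: "real^'n \<Rightarrow> real" and c p0 :: "real^'n" and \<epsilon> r \<delta> :: real
  assumes eps: "0 < \<epsilon>" "\<epsilon> < 1"
    and g: "convex_on pos_orthant g"
    and slater: "p0 \<in> prob_simplex" "p0 \<in> pos_orthant" "g p0 < r"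
    and ub: "\<And>q p. q \<in> prob_simplex \<Longrightarrow> p \<in> prob_simplex \<Longrightarrow> p \<in> pos_orthant \<Longrightarrow> g p \<le> r
      \<Longrightarrow> q \<le> (1 / \<epsilon>) *\<^sub>R p \<Longrightarrow> c \<bullet> q \<le> \<delta>"
  shows "\<exists>w \<beta> \<eta> l. 0 \<le> w \<and> 0 \<le> l \<and> (\<forall>i. c $ i - w $ i \<le> \<beta>) \<and>
    (\<forall>p\<in>pos_orthant.
       \<beta> + 1 / \<epsilon> * (\<eta> + l * r + (\<Sum>i\<in>UNIV. (w $ i - \<eta>) * p $ i) - l * g p) \<le> \<delta>)"
proof -
  define S where "S = {(t :: real, y :: real^'n, x :: real, A :: real, B :: real).
    \<exists>q p. 0 \<le> q \<and> p \<in> pos_orthant \<and> t < c \<bullet> q - \<delta> \<and> y \<le> (1 / \<epsilon>) *\<^sub>R p - q \<and> x \<le> r - g p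
      \<and> A = (\<Sum>i\<in>UNIV. q $ i) - 1 \<and> B = (\<Sum>i\<in>UNIV. p $ i) - 1}"
  have "convex S" unfolding S_def by (rule convex_slack_set[OF g])
  moreover have "0 \<notin> S"
  proof
    assume "0 \<in> S"
    then obtain q p where *: "0 \<le> q" "p \<in> pos_orthant" "0 < c \<bullet> q - \<delta>" "0 \<le> (1 / \<epsilon>) *\<^sub>R p - q"
        "0 \<le> r - g p" "(\<Sum>i\<in>UNIV. q $ i) = 1" "(\<Sum>i\<in>UNIV. p $ i) = 1"
      by (auto simp: S_def zero_prod_def)
    then have "0 \<le> p" by (auto simp: pos_orthant_def less_eq_vec_def intro: less_imp_le)
    then have "c \<bullet> q \<le> \<delta>"
      using * by (intro ub) (simp_all add: prob_simplex_def)
    with *(3) show False by simp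
  qed
  ultimately obtain k where "k \<noteq> 0" and k: "\<And>s. s \<in> S \<Longrightarrow> 0 \<le> k \<bullet> s"
    using separating_hyperplane_set_0[of S] by blast
  obtain k1 k2 k3 k4 k5 where k_eq: "k = (k1, k2, k3, k4, k5)" by (metis prod.exhaust)
  have sep: "0 \<le> k1 * t + k2 \<bullet> y + k3 * x + k4 * ((\<Sum>i\<in>UNIV. q $ i) - 1) + k5 * ((\<Sum>i\<in>UNIV. p $ i) - 1)"
    if "0 \<le> q" "p \<in> pos_orthant" "t < c \<bullet> q - \<delta>" "y \<le> (1 / \<epsilon>) *\<^sub>R p - q" "x \<le> r - g p"
    for q p t y x
    using k[of "(t, y, x, (\<Sum>i\<in>UNIV. q $ i) - 1, (\<Sum>i\<in>UNIV. p $ i) - 1)"] that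
    unfolding k_eq by (auto simp: S_def add.assoc)
  have p0: "0 \<le> p0" "(\<Sum>i\<in>UNIV. p0 $ i) = 1" using slater by (auto simp: prob_simplex_def)
  let ?y0 = "(1 / \<epsilon>) *\<^sub>R p0 - p0" and ?t0 = "c \<bullet> p0 - \<delta> - 1" and ?x0 = "r - g p0"
  have sep0: "0 \<le> k1 * t + k2 \<bullet> y + k3 * x"
    if "t \<le> ?t0" "y \<le> ?y0" "x \<le> ?x0" for t y x
    using sep[of p0 p0 t y x] that p0 slater(2) by simp
  \<comment> \<open>Slacks can be decreased without bound, which fixes the signs of the coefficients.\<close>
  have k1: "k1 \<le> 0"
    using sep0[of _ ?y0 ?x0]
    by (intro slope_nonpos[of ?t0 k1 "k2 \<bullet> ?y0 + k3 * ?x0"]) (simp add: add.assoc)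
  have k3: "k3 \<le> 0"
    using sep0[of ?t0 ?y0 _]
    by (intro slope_nonpos[of ?x0 k3 "k1 * ?t0 + k2 \<bullet> ?y0"]) (simp add: algebra_simps)
  have k2: "k2 \<le> 0"
    unfolding less_eq_vec_def
  proof
    fix i
    have "0 \<le> (k2 $ i) * z + (k1 * ?t0 + k2 \<bullet> ?y0 + k3 * ?x0)" if "z \<le> 0" for z
    proof -
      have "?y0 + z *\<^sub>R axis i 1 \<le> ?y0" using that by (auto simp: less_eq_vec_def axis_def)
      then show ?thesis
        using sep0[of ?t0 "?y0 + z *\<^sub>R axis i 1" ?x0] by (simp add: inner_simps inner_axis algebra_simps)
    qed
    then have "k2 $ i \<le> 0" by (rule slope_nonpos)
    then show "k2 $ i \<le> 0 $ i" by simp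
  qed
  have sep': "0 \<le> k1 * (c \<bullet> q - \<delta>) + k2 \<bullet> ((1 / \<epsilon>) *\<^sub>R p - q) + k3 * (r - g p)
      + k4 * ((\<Sum>i\<in>UNIV. q $ i) - 1) + k5 * ((\<Sum>i\<in>UNIV. p $ i) - 1)" (is "0 \<le> ?R")
    if "0 \<le> q" "p \<in> pos_orthant" for q p
  proof (rule field_le_epsilon)
    fix e :: real assume "0 < e"
    \<comment> \<open>Dividing by \<open>1 - k1 > 0\<close> covers \<open>k1 = 0\<close> as well.\<close>
    then have "0 \<le> ?R - k1 * (e / (1 - k1))"
      using sep[of q p "c \<bullet> q - \<delta> - e / (1 - k1)" "(1 / \<epsilon>) *\<^sub>R p - q" "r - g p"] that k1
      by (simp add: algebra_simps)
    moreover have "- k1 * (e / (1 - k1)) \<le> e"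
      using k1 \<open>0 < e\<close> by (simp add: field_simps)
    ultimately show "0 \<le> ?R + e" by simp
  qed
  have "k1 \<noteq> 0"
  proof
    assume "k1 = 0"
    have y0_pos: "0 < ?y0 $ i" for i
    proof -
      have "p0 $ i < p0 $ i / \<epsilon>"
        using eps slater(2) by (simp add: field_simps pos_orthant_def)
      then show ?thesis by simp
    qed
    have eq: "0 \<le> k2 \<bullet> ?y0 + k3 * ?x0" using sep0[of ?t0 ?y0 ?x0] \<open>k1 = 0\<close> by simp
    have "0 \<le> (- k2) \<bullet> ?y0"
      using k2 y0_pos by (intro inner_nonneg_vec) (auto simp: less_eq_vec_def intro: less_imp_le)
    moreover have "0 \<le> (- k3) * ?x0" using k3 slater(3) by (intro mult_nonneg_nonneg) auto
    moreover have "(- k2) \<bullet> ?y0 = - (k2 \<bullet> ?y0)" "(- k3) * ?x0 = - (k3 * ?x0)" by simp_all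
    ultimately have 0: "(- k2) \<bullet> ?y0 = 0" "k3 * ?x0 = 0" using eq by linarith+
    from 0(2) have "k3 = 0" using slater(3) by simp
    have "k2 = 0"
    proof -
      have "\<forall>i\<in>UNIV. (- k2) $ i \<bullet> ?y0 $ i = 0"
        using 0(1) k2 y0_pos
        by (subst (asm) inner_vec_def, subst (asm) sum_nonneg_eq_0_iff)
           (auto simp: less_eq_vec_def mult_nonpos_nonneg less_imp_le)
      then have "k2 $ i = 0" for i using y0_pos[of i] by auto
      then show ?thesis by (simp add: vec_eq_iff)
    qed
    have *: "0 \<le> k4 * ((\<Sum>i\<in>UNIV. q $ i) - 1) + k5 * ((\<Sum>i\<in>UNIV. p $ i) - 1)"
      if "0 \<le> q" "p \<in> pos_orthant" for q p :: "real^'n"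
      using sep'[OF that] \<open>k1 = 0\<close> \<open>k2 = 0\<close> \<open>k3 = 0\<close> by simp
    have half: "(1/2) *\<^sub>R p0 \<in> pos_orthant" and two: "2 *\<^sub>R p0 \<in> pos_orthant" "0 \<le> 2 *\<^sub>R p0"
      using slater(2) p0 by (auto simp: pos_orthant_def less_eq_vec_def)
    have "k4 = 0"
      using *[of 0 p0] *[of "2 *\<^sub>R p0" p0] two slater(2) p0
      by (simp add: sum_distrib_left[symmetric])
    moreover have "k5 = 0"
      using *[of p0 "2 *\<^sub>R p0"] *[of p0 "(1/2) *\<^sub>R p0"] two half p0
      by (simp add: sum_distrib_left[symmetric] sum_divide_distrib[symmetric])
    ultimately show False
      using \<open>k \<noteq> 0\<close> \<open>k1 = 0\<close> \<open>k2 = 0\<close> \<open>k3 = 0\<close> k_eq by (simp add: zero_prod_def)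
  qed
  with k1 have tau: "0 < - k1" by simp
  \<comment> \<open>Normalize by \<open>k1\<close>; the factor \<open>\<epsilon>\<close> in \<open>\<eta>\<close> and \<open>l\<close> lets \<open>1 / \<epsilon>\<close> be factored out of the dual objective.\<close>
  define w where "w = (1 / k1) *\<^sub>R k2"
  define \<beta> where "\<beta> = - k4 / k1"
  define \<eta> where "\<eta> = - \<epsilon> * k5 / k1"
  define l where "l = \<epsilon> * k3 / k1"
  have main: "c \<bullet> q - \<delta> + w \<bullet> ((1 / \<epsilon>) *\<^sub>R p - q) + l / \<epsilon> * (r - g p)
      \<le> \<beta> * ((\<Sum>i\<in>UNIV. q $ i) - 1) + \<eta> / \<epsilon> * ((\<Sum>i\<in>UNIV. p $ i) - 1)"
    if "0 \<le> q" "p \<in> pos_orthant" for q p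
  proof -
    let ?T = "\<lambda>k1 W. k1 * (c \<bullet> q - \<delta>) + W + k3 * (r - g p)
      + k4 * ((\<Sum>i\<in>UNIV. q $ i) - 1) + k5 * ((\<Sum>i\<in>UNIV. p $ i) - 1)"
    have "?T k1 (k2 \<bullet> ((1 / \<epsilon>) *\<^sub>R p - q)) / k1 \<le> 0"
      using sep'[OF that] tau by (simp add: divide_nonneg_neg)
    moreover have "w \<bullet> ((1 / \<epsilon>) *\<^sub>R p - q) = (k2 \<bullet> ((1 / \<epsilon>) *\<^sub>R p - q)) / k1"
      unfolding w_def by simp
    moreover have "l / \<epsilon> = k3 / k1" "\<eta> / \<epsilon> = - k5 / k1"
      using eps by (simp_all add: l_def \<eta>_def)
    ultimately show ?thesis
      using tau by (simp add: \<beta>_def add_divide_distrib)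
  qed
  show ?thesis
  proof (intro exI conjI allI ballI)
    show "0 \<le> w" using k2 tau unfolding w_def less_eq_vec_def
      by (auto intro!: divide_nonpos_neg)
    show "0 \<le> l" using k3 tau eps unfolding l_def
      by (intro divide_nonpos_neg mult_nonneg_nonpos) auto
    show "c $ i - w $ i \<le> \<beta>" for i
    proof -
      have "0 \<le> (c $ i - w $ i - \<beta>) * z + (\<delta> - w \<bullet> ((1 / \<epsilon>) *\<^sub>R p0) - l / \<epsilon> * (r - g p0) - \<beta>)"
        if "z \<le> 0" for z
      proof -
        have "(\<Sum>j\<in>UNIV. axis i (- z) $ j) = - z"
          by (simp add: axis_def)
        moreover have "0 \<le> axis i (- z)" using that by (auto simp: less_eq_vec_def axis_def)
        ultimately show ?thesis
          using main[of "axis i (- z)" p0] p0 slater(2)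
          by (simp add: inner_simps inner_axis algebra_simps)
      qed
      then have "c $ i - w $ i - \<beta> \<le> 0" by (rule slope_nonpos)
      then show ?thesis by simp
    qed
    fix p :: "real^'n" assume "p \<in> pos_orthant"
    have "(\<Sum>i\<in>UNIV. (w $ i - \<eta>) * p $ i) = w \<bullet> p - \<eta> * (\<Sum>i\<in>UNIV. p $ i)"
      by (simp add: inner_vec_def algebra_simps sum_subtractf sum_distrib_left)
    then have "\<beta> + 1 / \<epsilon> * (\<eta> + l * r + (\<Sum>i\<in>UNIV. (w $ i - \<eta>) * p $ i) - l * g p)
      = \<beta> + w \<bullet> p / \<epsilon> + l / \<epsilon> * (r - g p) - \<eta> / \<epsilon> * ((\<Sum>i\<in>UNIV. p $ i) - 1)"
      using eps by (simp only:) (simp add: field_simps)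
    then show "\<beta> + 1 / \<epsilon> * (\<eta> + l * r + (\<Sum>i\<in>UNIV. (w $ i - \<eta>) * p $ i) - l * g p) \<le> \<delta>"
      using main[of 0 p] \<open>p \<in> pos_orthant\<close> by simp
  qed
qed

section \<open>Separable concave problems and their conjugates\<close>

text \<open>A bound on a separable sum bounds each summand: put \<open>1\<close> into the other coordinates.\<close>

lemma separable_bound:
  fixes \<phi> :: "'n::finite \<Rightarrow> real \<Rightarrow> real"
  assumes bd: "\<And>p. p \<in> pos_orthant \<Longrightarrow> (\<Sum>i\<in>UNIV. \<phi> i (p $ i)) \<le> B"
  obtains K where "\<And>x. 0 < x \<Longrightarrow> \<phi> i x \<le> K"
proof
  fix x :: real assume "0 < x"
  let ?p = "\<chi> j. if j = i then x else 1"
  have "(\<Sum>j\<in>UNIV. \<phi> j (?p $ j)) = \<phi> i x + (\<Sum>j\<in>UNIV - {i}. \<phi> j 1)"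
    by (subst sum.remove[of UNIV i]) (auto intro!: sum.cong)
  moreover have "?p \<in> pos_orthant" using \<open>0 < x\<close> by (simp add: pos_orthant_def)
  ultimately show "\<phi> i x \<le> B - (\<Sum>j\<in>UNIV - {i}. \<phi> j 1)"
    using bd[of ?p] by linarith
qed

text \<open>Near-maximizers can be chosen in each coordinate independently. The \<open>z i\<close> are only approximated,
  because in degenerate cases the conjugates below are not attained.\<close>

lemma separable_sup_le:
  fixes \<phi> :: "'n::finite \<Rightarrow> real \<Rightarrow> real"
  assumes bd: "\<And>p. p \<in> pos_orthant \<Longrightarrow> (\<Sum>i\<in>UNIV. \<phi> i (p $ i)) \<le> B"
    and z: "\<And>i e. 0 < e \<Longrightarrow> \<exists>x>0. z i - e \<le> \<phi> i x"
  shows "(\<Sum>i\<in>UNIV. z i) \<le> B"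
proof (rule field_le_epsilon)
  fix e :: real assume "0 < e"
  then have "\<forall>i. \<exists>x>0. z i - e / real CARD('n) \<le> \<phi> i x" by (intro allI z) simp
  then obtain x where x: "\<And>i. 0 < x i" "\<And>i. z i - e / real CARD('n) \<le> \<phi> i (x i)" by metis
  have "(\<Sum>i\<in>UNIV. z i - e / real CARD('n)) \<le> (\<Sum>i\<in>UNIV. \<phi> i ((\<chi> i. x i) $ i))"
    using x by (intro sum_mono) auto
  also have "\<dots> \<le> B" using x by (intro bd) (auto simp: pos_orthant_def)
  finally show "(\<Sum>i\<in>UNIV. z i) \<le> B + e" by (simp add: sum_subtractf)
qed

lemma slope_nonpos_of_bounded:
  fixes d C :: real
  assumes "\<And>x. 1 \<le> x \<Longrightarrow> d * x \<le> C"
  shows "d \<le> 0"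
proof (rule ccontr)
  assume "\<not> d \<le> 0"
  then have "0 < d" by simp
  have "C + 1 = d * ((C + 1) / d)" using \<open>0 < d\<close> by simp
  also have "\<dots> \<le> d * max 1 ((C + 1) / d)" using \<open>0 < d\<close> by (intro mult_left_mono) auto
  also have "\<dots> \<le> C" by (rule assms) simp
  finally show False by simp
qed

text \<open>Half of the identity \<open>- 2 h \<surd>(l y) = sup {- y x - l h\<^sup>2 / x | x > 0}\<close>. If \<open>l\<close>, \<open>h\<close>, \<open>y\<close> are all positive the
  supremum is attained at \<open>x = h \<surd>(l / y)\<close>; otherwise it is approached as \<open>x\<close> tends to \<open>0\<close> or to
  infinity.\<close>

lemma chi_conjugate:
  fixes l y h e :: real
  assumes "0 \<le> l" "0 \<le> y" "0 \<le> h" "0 < e"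
  shows "\<exists>x>0. - 2 * h * sqrt (l * y) - e \<le> - y * x - l * (h\<^sup>2 / x)"
proof -
  consider "h = 0 \<or> l = 0" | "0 < h" "0 < l" "y = 0" | "0 < h" "0 < l" "0 < y"
    using assms by fastforce
  then show ?thesis
  proof cases
    case 1
    have "y * (e / (y + 1)) \<le> e" using assms by (simp add: divide_le_eq algebra_simps)
    with 1 show ?thesis using assms by (intro exI[of _ "e / (y + 1)"]) auto
  next
    case 2
    then show ?thesis
      using assms by (intro exI[of _ "l * h\<^sup>2 / e"]) (auto simp: field_simps)
  next
    case 3
    define a b where "a = sqrt l" and "b = sqrt y"
    have ab: "0 < a" "0 < b" "l = a\<^sup>2" "y = b\<^sup>2" using 3 by (auto simp: a_def b_def)
    have "- y * (h * a / b) - l * (h\<^sup>2 / (h * a / b)) = - 2 * h * (a * b)"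
      using 3 ab by (simp add: field_simps power2_eq_square)
    moreover have "sqrt (l * y) = a * b" by (simp add: a_def b_def real_sqrt_mult)
    ultimately show ?thesis
      using 3 ab assms by (intro exI[of _ "h * a / b"]) auto
  qed
qed

text \<open>The analogue for the logarithmic divergence, with maximizer \<open>x = l h / y\<close>. For \<open>l, h > 0\<close>
  and \<open>y = 0\<close> the supremum is infinite, whence the last hypothesis.\<close>

lemma G_conjugate:
  fixes l y h e :: real
  assumes "0 \<le> l" "0 \<le> y" "0 \<le> h" "0 < e" and "l = 0 \<or> h = 0 \<or> 0 < y"
  shows "\<exists>x>0. (if l = 0 \<or> h = 0 then 0 else - l * h * ln (y / l) - l * h) - e
    \<le> - y * x - l * (h * ln (h / x))"
proof (cases "l = 0 \<or> h = 0")
  case True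
  have "y * (e / (y + 1)) \<le> e" using assms by (simp add: divide_le_eq algebra_simps)
  with True show ?thesis using assms by (intro exI[of _ "e / (y + 1)"]) auto
next
  case False
  with assms have pos: "0 < l" "0 < h" "0 < y" by auto
  then have "y * (l * h / y) = l * h" "h / (l * h / y) = y / l" by (auto simp: field_simps)
  with pos assms show ?thesis
    by (intro exI[of _ "l * h / y"]) (auto simp: algebra_simps)
qed

lemma convex_on_pos_orthant_sum:
  fixes h :: "'n::finite \<Rightarrow> real \<Rightarrow> real"
  assumes "\<And>i. convex_on {0<..} (h i)"
  shows "convex_on pos_orthant (\<lambda>p :: real^'n. \<Sum>i\<in>UNIV. h i (p $ i))"
  unfolding convex_on_def
proof (intro conjI ballI allI impI)
  show "convex (pos_orthant :: (real^'n) set)" by (rule convex_pos_orthant)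
next
  fix p q :: "real^'n" and u v :: real
  assume *: "p \<in> pos_orthant" "q \<in> pos_orthant" "0 \<le> u" "0 \<le> v" "u + v = 1"
  have "(\<Sum>i\<in>UNIV. h i ((u *\<^sub>R p + v *\<^sub>R q) $ i)) \<le> (\<Sum>i\<in>UNIV. u * h i (p $ i) + v * h i (q $ i))"
  proof (rule sum_mono)
    fix i
    show "h i ((u *\<^sub>R p + v *\<^sub>R q) $ i) \<le> u * h i (p $ i) + v * h i (q $ i)"
      using assms[of i] * by (auto simp: convex_on_def pos_orthant_def)
  qed
  then show "(\<Sum>i\<in>UNIV. h i ((u *\<^sub>R p + v *\<^sub>R q) $ i))
    \<le> u * (\<Sum>i\<in>UNIV. h i (p $ i)) + v * (\<Sum>i\<in>UNIV. h i (q $ i))"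
    by (simp add: sum.distrib sum_distrib_left)
qed

lemma convex_on_chi_divergence: "convex_on {0<..} (\<lambda>x. h\<^sup>2 / x :: real)"
proof -
  have "convex_on {0<..} (\<lambda>x. h\<^sup>2 * inverse x)"
    by (intro convex_on_cmul convex_on_inverse) auto
  then show ?thesis by (simp add: divide_inverse)
qed

lemma convex_on_log_divergence:
  assumes "0 \<le> h"
  shows "convex_on {0<..} (\<lambda>x. h * ln (h / x) :: real)"
proof (cases "h = 0")
  case False
  with assms have "0 < h" by simp
  show ?thesis
    unfolding convex_on_def
  proof (intro conjI ballI allI impI)
    fix x y u v :: real
    assume *: "x \<in> {0<..}" "y \<in> {0<..}" "0 \<le> u" "0 \<le> v" "u + v = 1"
    then have u: "u = 1 - v" by simp
    have pos: "0 < u * x + v * y"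
      using convexD[OF convex_real_interval(3)[of 0] *(1,2) *(3,4,5)] by simp
    have "u * ln x + v * ln y \<le> ln (u * x + v * y)"
      using concave_onD[OF ln_concave, of v x y] * unfolding u by simp
    then have "ln h - ln (u * x + v * y) \<le> u * (ln h - ln x) + v * (ln h - ln y)"
      unfolding u by (simp add: algebra_simps)
    then have "h * (ln h - ln (u * x + v * y)) \<le> h * (u * (ln h - ln x) + v * (ln h - ln y))"
      using \<open>0 < h\<close> by (intro mult_left_mono) auto
    then show "h * ln (h / (u *\<^sub>R x + v *\<^sub>R y)) \<le> u * (h * ln (h / x)) + v * (h * ln (h / y))"
      using * pos \<open>0 < h\<close> by (simp add: ln_div algebra_simps)
  qed auto
qed (simp add: convex_on_const)

section \<open>The confidence regions\<close>

lemma sum_ereal_if: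
  fixes f :: "'i::finite \<Rightarrow> real"
  shows "(\<Sum>i\<in>UNIV. if bad i then \<infinity> else ereal (f i))
    = (if \<exists>i. bad i then \<infinity> else ereal (\<Sum>i\<in>UNIV. f i))"
proof (cases "\<exists>i. bad i")
  case True
  then have "(\<Sum>i\<in>UNIV. if bad i then \<infinity> else ereal (f i)) = \<infinity>" by (subst sum_Pinfty) auto
  with True show ?thesis by simp
qed auto

text \<open>Expanding the square turns the divergence into \<open>(\<Sum>ph\<^sup>2/p - 1) / 2\<close>. With the default value
  \<open>c / 0 = 0\<close> of real division, the infinite terms become the separate condition that \<open>p\<close> vanishes
  only where \<open>ph\<close> does.\<close>

lemma pearson_le_iff:
  fixes ph p :: "real^'n"
  assumes "ph \<in> prob_simplex" "p \<in> prob_simplex"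
  shows "(\<Sum>i\<in>UNIV. pearson_term (ph $ i) (p $ i)) \<le> ereal R
    \<longleftrightarrow> (\<forall>i. p $ i = 0 \<longrightarrow> ph $ i = 0) \<and> (\<Sum>i\<in>UNIV. (ph $ i)\<^sup>2 / p $ i) \<le> 1 + 2 * R"
proof -
  have "pearson_term (ph $ i) (p $ i) = (if p $ i = 0 \<and> ph $ i \<noteq> 0 then \<infinity>
      else ereal ((p $ i - ph $ i)\<^sup>2 / (2 * p $ i)))" for i
    by (auto simp: pearson_term_def zero_ereal_def)
  moreover have "(\<Sum>i\<in>UNIV. (p $ i - ph $ i)\<^sup>2 / (2 * p $ i))
      = ((\<Sum>i\<in>UNIV. (ph $ i)\<^sup>2 / p $ i) - 1) / 2"
    if "\<forall>i. p $ i = 0 \<longrightarrow> ph $ i = 0"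
  proof -
    have "(\<Sum>i\<in>UNIV. (p $ i - ph $ i)\<^sup>2 / (2 * p $ i))
      = (\<Sum>i\<in>UNIV. ((ph $ i)\<^sup>2 / p $ i) / 2 + p $ i / 2 - ph $ i)"
    proof (rule sum.cong)
      fix i
      show "(p $ i - ph $ i)\<^sup>2 / (2 * p $ i) = ((ph $ i)\<^sup>2 / p $ i) / 2 + p $ i / 2 - ph $ i"
        using that by (cases "p $ i = 0") (auto simp: field_simps power2_eq_square)
    qed simp
    also have "\<dots> = (\<Sum>i\<in>UNIV. (ph $ i)\<^sup>2 / p $ i) / 2 + (\<Sum>i\<in>UNIV. p $ i) / 2 - (\<Sum>i\<in>UNIV. ph $ i)"
      unfolding sum.distrib sum_subtractf sum_divide_distrib ..
    also have "\<dots> = ((\<Sum>i\<in>UNIV. (ph $ i)\<^sup>2 / p $ i) - 1) / 2"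
      using assms by (simp add: prob_simplex_def)
    finally show ?thesis .
  qed
  ultimately show ?thesis by (auto simp: sum_ereal_if)
qed

lemma rel_entropy_le_iff:
  fixes ph p :: "real^'n"
  shows "rel_entropy ph p \<le> ereal R
    \<longleftrightarrow> (\<forall>i. p $ i = 0 \<longrightarrow> ph $ i = 0) \<and> (\<Sum>i\<in>UNIV. ph $ i * ln (ph $ i / p $ i)) \<le> R"
proof -
  have "rel_entropy_term (ph $ i) (p $ i) = (if p $ i = 0 \<and> ph $ i \<noteq> 0 then \<infinity>
      else ereal (ph $ i * ln (ph $ i / p $ i)))" for i
    by (auto simp: rel_entropy_term_def zero_ereal_def)
  then show ?thesis by (auto simp: rel_entropy_def sum_ereal_if)
qed

section \<open>Reduction to the confidence region\<close>

lemma inner_uncertainty_point: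
  fixes a :: "'n::finite \<Rightarrow> 'b::real_inner"
  shows "v \<bullet> (\<Sum>j\<in>UNIV. (q $ j) *\<^sub>R a j) = (\<Sum>j\<in>UNIV. q $ j * (a j \<bullet> v))"
  by (simp add: inner_sum_right inner_commute)

lemma prob_simplex_le_scaled:
  fixes p :: "real^'n"
  assumes "p \<in> prob_simplex" "0 < \<epsilon>" "\<epsilon> < 1"
  shows "p \<le> (1 / \<epsilon>) *\<^sub>R p"
proof -
  have "p $ i \<le> p $ i / \<epsilon>" for i
    using assms mult_left_mono[of \<epsilon> 1 "p $ i"]
    by (simp add: prob_simplex_def less_eq_vec_def field_simps)
  then show ?thesis by (simp add: less_eq_vec_def)
qed

text \<open>The support function is a real number: \<open>q\<close> ranges over the simplex, and \<open>q = p\<close> is admissible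
  because \<open>\<epsilon> < 1\<close>.\<close>

lemma support_fun_uncertainty_set:
  fixes a :: "'n::finite \<Rightarrow> 'b::real_inner"
  assumes "R \<subseteq> prob_simplex" "p0 \<in> R" "0 < \<epsilon>" "\<epsilon> < 1"
  obtains \<delta> where "support_fun (uncertainty_set a R \<epsilon>) v = ereal \<delta>"
    "\<And>q p. q \<in> prob_simplex \<Longrightarrow> p \<in> R \<Longrightarrow> q \<le> (1 / \<epsilon>) *\<^sub>R p
       \<Longrightarrow> (\<Sum>j\<in>UNIV. q $ j * (a j \<bullet> v)) \<le> \<delta>"
proof -
  let ?s = "support_fun (uncertainty_set a R \<epsilon>) v"
  have ge: "ereal (\<Sum>j\<in>UNIV. q $ j * (a j \<bullet> v)) \<le> ?s"
    if "q \<in> prob_simplex" "p \<in> R" "q \<le> (1 / \<epsilon>) *\<^sub>R p" for q p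
  proof -
    have "(\<Sum>j\<in>UNIV. (q $ j) *\<^sub>R a j) \<in> uncertainty_set a R \<epsilon>"
      using that unfolding uncertainty_set_def by blast
    then have "ereal (v \<bullet> (\<Sum>j\<in>UNIV. (q $ j) *\<^sub>R a j)) \<le> ?s"
      unfolding support_fun_def by (rule SUP_upper)
    then show ?thesis by (simp add: inner_uncertainty_point)
  qed
  have "?s \<le> ereal (\<Sum>j\<in>UNIV. \<bar>a j \<bullet> v\<bar>)"
    unfolding support_fun_def
  proof (rule SUP_least)
    fix u assume "u \<in> uncertainty_set a R \<epsilon>"
    then obtain q where u: "u = (\<Sum>j\<in>UNIV. (q $ j) *\<^sub>R a j)" and q: "q \<in> prob_simplex"
      unfolding uncertainty_set_def by blast
    have "q $ j * (a j \<bullet> v) \<le> \<bar>a j \<bullet> v\<bar>" for j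
    proof -
      have q0: "0 \<le> q $ k" for k using q by (simp add: prob_simplex_def less_eq_vec_def)
      have "q $ j \<le> (\<Sum>k\<in>UNIV. q $ k)" using q0 by (intro member_le_sum) auto
      then have "q $ j \<le> 1" using q by (simp add: prob_simplex_def)
      then have "\<bar>q $ j * (a j \<bullet> v)\<bar> \<le> 1 * \<bar>a j \<bullet> v\<bar>"
        using q0[of j] unfolding abs_mult by (intro mult_right_mono) auto
      then show ?thesis by simp
    qed
    then show "ereal (v \<bullet> u) \<le> ereal (\<Sum>j\<in>UNIV. \<bar>a j \<bullet> v\<bar>)"
      unfolding u by (simp add: inner_uncertainty_point sum_mono)
  qed
  moreover have "ereal (\<Sum>j\<in>UNIV. p0 $ j * (a j \<bullet> v)) \<le> ?s"
    using assms by (intro ge[of p0 p0] prob_simplex_le_scaled) auto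
  ultimately obtain \<delta> where "?s = ereal \<delta>" by (cases ?s) auto
  with ge that show thesis by auto
qed

lemma support_fun_uncertainty_set_le:
  fixes a :: "'n::finite \<Rightarrow> 'b::real_inner"
  assumes "\<And>q p. q \<in> prob_simplex \<Longrightarrow> p \<in> R \<Longrightarrow> q \<le> (1 / \<epsilon>) *\<^sub>R p
       \<Longrightarrow> ereal (\<Sum>j\<in>UNIV. q $ j * (a j \<bullet> v)) \<le> B"
  shows "support_fun (uncertainty_set a R \<epsilon>) v \<le> B"
  unfolding support_fun_def
  by (rule SUP_least) (auto simp: uncertainty_set_def inner_uncertainty_point assms)

text \<open>Weak duality for the constraint \<open>q \<le> p / \<epsilon>\<close>, the dual form of conditional value at risk:
  \<open>w\<close> prices the constraint and \<open>\<beta>\<close> the normalization of \<open>q\<close>.\<close>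

lemma expectation_le_scaled:
  fixes p q w :: "real^'n"
  assumes "q \<in> prob_simplex" "q \<le> (1 / \<epsilon>) *\<^sub>R p" "0 \<le> w" "\<And>i. c i - w $ i \<le> \<beta>"
  shows "(\<Sum>i\<in>UNIV. q $ i * c i) \<le> \<beta> + 1 / \<epsilon> * (\<Sum>i\<in>UNIV. p $ i * w $ i)"
proof -
  have "(\<Sum>i\<in>UNIV. q $ i * c i) \<le> (\<Sum>i\<in>UNIV. q $ i * \<beta> + 1 / \<epsilon> * (p $ i * w $ i))"
  proof (rule sum_mono)
    fix i
    have "q $ i * (c i - w $ i) \<le> q $ i * \<beta>"
      using assms by (intro mult_left_mono) (auto simp: prob_simplex_def less_eq_vec_def)
    moreover have "q $ i * w $ i \<le> (1 / \<epsilon> * p $ i) * w $ i"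
      using assms(2,3) by (intro mult_right_mono) (auto simp: less_eq_vec_def)
    ultimately show "q $ i * c i \<le> q $ i * \<beta> + 1 / \<epsilon> * (p $ i * w $ i)"
      by (simp add: algebra_simps)
  qed
  also have "\<dots> = \<beta> + 1 / \<epsilon> * (\<Sum>i\<in>UNIV. p $ i * w $ i)"
    using assms(1)
    by (simp add: sum.distrib prob_simplex_def flip: sum_distrib_left sum_distrib_right sum_divide_distrib)
  finally show ?thesis .
qed

lemma is_minimumI:
  assumes "\<And>x. x \<in> F \<Longrightarrow> m \<le> f x" "xm \<in> F" "f xm \<le> m"
  shows "is_minimum f F m"
  using assms unfolding is_minimum_def by (auto intro!: bexI[of _ xm] antisym)

text \<open>Mixing \<open>ph\<close> with the uniform distribution makes all coordinates positive, while the bound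
  \<open>\<theta> ph \<le> p\<close> keeps both divergences of \<open>p\<close> from \<open>ph\<close> small when \<open>\<theta>\<close> is close to \<open>1\<close>.\<close>

lemma slater_point:
  fixes ph :: "real^'n"
  assumes "ph \<in> prob_simplex" "0 < \<theta>" "\<theta> < 1"
  obtains p where "p \<in> prob_simplex" "p \<in> pos_orthant" "\<And>i. \<theta> * ph $ i \<le> p $ i"
proof
  let ?p = "\<chi> i. \<theta> * ph $ i + (1 - \<theta>) / real CARD('n)"
  have ph: "0 \<le> ph $ i" for i using assms by (simp add: prob_simplex_def less_eq_vec_def)
  show "\<theta> * ph $ i \<le> ?p $ i" for i using assms by simp
  show "?p \<in> pos_orthant"
    using assms ph unfolding pos_orthant_def by (auto intro!: add_nonneg_pos mult_nonneg_nonneg)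
  then show "?p \<in> prob_simplex"
    using assms unfolding pos_orthant_def
    by (auto simp: prob_simplex_def less_eq_vec_def sum.distrib less_imp_le simp flip: sum_distrib_left)
qed

text \<open>The multipliers for a separable divergence, rearranged so that the dual inequality becomes a
  bound on a sum of functions of one variable each.\<close>

lemma separable_lagrange_multipliers:
  fixes h :: "'n::finite \<Rightarrow> real \<Rightarrow> real" and p0 :: "real^'n" and a :: "'n \<Rightarrow> 'b::real_inner"
  assumes eps: "0 < \<epsilon>" "\<epsilon> < 1" and h: "\<And>i. convex_on {0<..} (h i)"
    and p0: "p0 \<in> prob_simplex" "p0 \<in> pos_orthant" "(\<Sum>i\<in>UNIV. h i (p0 $ i)) < r"
    and ub: "\<forall>q\<in>prob_simplex. \<forall>p\<in>prob_simplex \<inter> pos_orthant.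
      (\<Sum>i\<in>UNIV. h i (p $ i)) \<le> r \<longrightarrow> q \<le> (1 / \<epsilon>) *\<^sub>R p
      \<longrightarrow> (\<Sum>i\<in>UNIV. q $ i * (a i \<bullet> v)) \<le> \<delta>"
  shows "\<exists>w \<beta> \<eta> l. (0 :: real^'n) \<le> w \<and> 0 \<le> l \<and> (\<forall>i. a i \<bullet> v - w $ i \<le> \<beta>) \<and>
    (\<forall>p\<in>pos_orthant. (\<Sum>i\<in>UNIV. (w $ i - \<eta>) * p $ i - l * h i (p $ i))
       \<le> \<epsilon> * (\<delta> - \<beta>) - \<eta> - l * r)"
proof -
  have cv: "convex_on pos_orthant (\<lambda>p :: real^'n. \<Sum>i\<in>UNIV. h i (p $ i))"
    by (intro convex_on_pos_orthant_sum h)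
  have "\<exists>w \<beta> \<eta> l. 0 \<le> w \<and> 0 \<le> l \<and> (\<forall>i. (\<chi> i. a i \<bullet> v) $ i - w $ i \<le> \<beta>) \<and>
    (\<forall>p\<in>pos_orthant. \<beta> + 1 / \<epsilon> * (\<eta> + l * r
      + (\<Sum>i\<in>UNIV. (w $ i - \<eta>) * p $ i) - l * (\<Sum>i\<in>UNIV. h i (p $ i))) \<le> \<delta>)"
  proof (rule lagrange_multipliers[OF eps cv p0])
    fix q p :: "real^'n"
    assume "q \<in> prob_simplex" "p \<in> prob_simplex" "p \<in> pos_orthant"
      "(\<Sum>i\<in>UNIV. h i (p $ i)) \<le> r" "q \<le> (1 / \<epsilon>) *\<^sub>R p"
    then have "(\<Sum>i\<in>UNIV. q $ i * (a i \<bullet> v)) \<le> \<delta>" using ub by blast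
    then show "(\<chi> i. a i \<bullet> v) \<bullet> q \<le> \<delta>" by (simp add: inner_vec_def mult.commute)
  qed
  then obtain w \<beta> \<eta> l where w: "0 \<le> w" "0 \<le> l" "\<forall>i. (\<chi> i. a i \<bullet> v) $ i - w $ i \<le> \<beta>"
    and L: "\<forall>p\<in>pos_orthant. \<beta> + 1 / \<epsilon> * (\<eta> + l * r
      + (\<Sum>i\<in>UNIV. (w $ i - \<eta>) * p $ i) - l * (\<Sum>i\<in>UNIV. h i (p $ i))) \<le> \<delta>"
    by blast
  have "(\<Sum>i\<in>UNIV. (w $ i - \<eta>) * p $ i - l * h i (p $ i)) \<le> \<epsilon> * (\<delta> - \<beta>) - \<eta> - l * r"
    if "p \<in> pos_orthant" for p
  proof -
    have "1 / \<epsilon> * (\<eta> + l * r + (\<Sum>i\<in>UNIV. (w $ i - \<eta>) * p $ i - l * h i (p $ i))) \<le> \<delta> - \<beta>"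
      using bspec[OF L that] by (simp only: sum_subtractf sum_distrib_left add_diff_eq le_diff_eq add.commute)
    then have "\<eta> + l * r + (\<Sum>i\<in>UNIV. (w $ i - \<eta>) * p $ i - l * h i (p $ i)) \<le> \<epsilon> * (\<delta> - \<beta>)"
      using eps by (simp add: divide_le_eq mult.commute)
    then show ?thesis by simp
  qed
  with w show ?thesis by (intro exI[of _ w] exI[of _ \<beta>] exI[of _ \<eta>] exI[of _ l]) simp
qed

section \<open>Pearson's region\<close>

lemma conf_region_chi_iff:
  fixes ph :: "real^'n"
  assumes "ph \<in> prob_simplex"
  shows "p \<in> conf_region_chi \<alpha> N ph \<longleftrightarrow> p \<in> prob_simplex \<and> (\<forall>i. p $ i = 0 \<longrightarrow> ph $ i = 0)
    \<and> (\<Sum>i\<in>UNIV. (ph $ i)\<^sup>2 / p $ i) \<le> 1 + chi_square_quantile (CARD('n) - 1) (1 - \<alpha>) / real N"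
  unfolding conf_region_chi_def using pearson_le_iff[OF assms, of p] by auto

text \<open>The cone constraint says \<open>s\<^sup>2 \<le> l (l - t)\<close>. For \<open>p > 0\<close> the claim is then the inequality between the
  geometric and the arithmetic mean of \<open>p (l - t)\<close> and \<open>l h\<^sup>2 / p\<close>.\<close>

lemma chi_young:
  fixes p h s t l :: real
  assumes "0 \<le> p" "0 \<le> h" "0 \<le> s" "0 \<le> l" "t \<le> l" and "p = 0 \<longrightarrow> h = 0"
    and cone: "norm (2 * s, t) \<le> 2 * l - t"
  shows "2 * (h * s) + p * t \<le> l * p + l * (h\<^sup>2 / p)"
proof (cases "p = 0")
  case False
  with assms have "0 < p" by simp
  have "(norm (2 * s, t))\<^sup>2 \<le> (2 * l - t)\<^sup>2" using cone by (intro power_mono) auto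
  then have s: "s\<^sup>2 \<le> l * (l - t)"
    by (simp add: norm_Pair algebra_simps power2_eq_square)
  have "2 * (h * p) * s \<le> (l - t) * p\<^sup>2 + l * h\<^sup>2"
  proof (rule power2_le_imp_le)
    have "(2 * (h * p) * s)\<^sup>2 \<le> 4 * (h * p)\<^sup>2 * (l * (l - t))"
      using mult_left_mono[OF s, of "4 * (h * p)\<^sup>2"] by (simp add: power_mult_distrib)
    also have "\<dots> \<le> ((l - t) * p\<^sup>2 + l * h\<^sup>2)\<^sup>2"
      using zero_le_power2[of "(l - t) * p\<^sup>2 - l * h\<^sup>2"]
      by (simp add: power2_eq_square algebra_simps)
    finally show "(2 * (h * p) * s)\<^sup>2 \<le> ((l - t) * p\<^sup>2 + l * h\<^sup>2)\<^sup>2" .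
    show "0 \<le> (l - t) * p\<^sup>2 + l * h\<^sup>2" using assms by simp
  qed
  then have "(2 * (h * p) * s) / p \<le> ((l - t) * p\<^sup>2 + l * h\<^sup>2) / p"
    using \<open>0 < p\<close> by (intro divide_right_mono) auto
  then show ?thesis using \<open>0 < p\<close> by (simp add: field_simps power2_eq_square)
qed (use assms in auto)

lemma chi_weak_duality:
  fixes ph p q w s :: "real^'n" and a :: "'n \<Rightarrow> 'b::real_inner"
  assumes "0 < \<epsilon>" "ph \<in> prob_simplex" "q \<in> prob_simplex" "p \<in> prob_simplex"
    and "q \<le> (1 / \<epsilon>) *\<^sub>R p" and supp: "\<forall>i. p $ i = 0 \<longrightarrow> ph $ i = 0"
    and C: "(\<Sum>i\<in>UNIV. (ph $ i)\<^sup>2 / p $ i) \<le> 1 + C"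
    and feas: "(w, s, \<beta>, \<eta>, l) \<in> chi_feasible a v"
  shows "(\<Sum>i\<in>UNIV. q $ i * (a i \<bullet> v))
    \<le> \<beta> + 1 / \<epsilon> * (\<eta> + l * C + 2 * l - 2 * (\<Sum>i\<in>UNIV. ph $ i * s $ i))"
proof -
  have "(\<Sum>i\<in>UNIV. 2 * (ph $ i * s $ i) + p $ i * (w $ i - \<eta>))
      \<le> (\<Sum>i\<in>UNIV. l * p $ i + l * ((ph $ i)\<^sup>2 / p $ i))"
  proof (rule sum_mono)
    fix i
    show "2 * (ph $ i * s $ i) + p $ i * (w $ i - \<eta>) \<le> l * p $ i + l * ((ph $ i)\<^sup>2 / p $ i)"
      using assms(2,4) supp feas
      by (intro chi_young) (auto simp: chi_feasible_def prob_simplex_def less_eq_vec_def algebra_simps)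
  qed
  also have "\<dots> = l + l * (\<Sum>i\<in>UNIV. (ph $ i)\<^sup>2 / p $ i)"
    unfolding sum.distrib sum_distrib_left[symmetric] using assms(4) by (simp add: prob_simplex_def)
  also have "\<dots> \<le> l + l * (1 + C)"
    using C feas by (intro add_left_mono mult_left_mono) (auto simp: chi_feasible_def)
  also have "(\<Sum>i\<in>UNIV. 2 * (ph $ i * s $ i) + p $ i * (w $ i - \<eta>))
      = 2 * (\<Sum>i\<in>UNIV. ph $ i * s $ i) + (\<Sum>i\<in>UNIV. p $ i * w $ i) - \<eta>"
    using assms(4)
    by (simp add: prob_simplex_def sum.distrib sum_subtractf right_diff_distrib
        flip: sum_distrib_left sum_distrib_right)
  finally have "(\<Sum>i\<in>UNIV. p $ i * w $ i) \<le> \<eta> + l * C + 2 * l - 2 * (\<Sum>i\<in>UNIV. ph $ i * s $ i)"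
    by (simp add: algebra_simps)
  then have "\<beta> + 1 / \<epsilon> * (\<Sum>i\<in>UNIV. p $ i * w $ i)
      \<le> \<beta> + 1 / \<epsilon> * (\<eta> + l * C + 2 * l - 2 * (\<Sum>i\<in>UNIV. ph $ i * s $ i))"
    using \<open>0 < \<epsilon>\<close> by (intro add_left_mono mult_left_mono) auto
  moreover have "(\<Sum>i\<in>UNIV. q $ i * (a i \<bullet> v)) \<le> \<beta> + 1 / \<epsilon> * (\<Sum>i\<in>UNIV. p $ i * w $ i)"
    using assms(3,5) feas by (intro expectation_le_scaled) (auto simp: chi_feasible_def)
  ultimately show ?thesis by linarith
qed

text \<open>The multipliers \<open>w, \<beta>, \<eta>, l\<close> give the dual solution after the shift \<open>\<eta> - l\<close>, which absorbs
  the \<open>1\<close> in the bound \<open>1 + C\<close> on \<open>\<Sum>ph\<^sup>2/p\<close>. The best \<open>s\<close> makes the cone constraint tight, and then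
  the terms of the objective are the conjugates of the one-variable problems. Boundedness of these
  problems for large \<open>p\<close> yields \<open>w \<le> \<eta>\<close>.\<close>

lemma chi_dual_attained:
  fixes ph :: "real^'n" and a :: "'n \<Rightarrow> 'b::real_inner"
  assumes eps: "0 < \<epsilon>" "\<epsilon> < 1" and ph: "ph \<in> prob_simplex" and "0 < C"
    and ub: "\<forall>q\<in>prob_simplex. \<forall>p\<in>prob_simplex \<inter> pos_orthant.
      (\<Sum>i\<in>UNIV. (ph $ i)\<^sup>2 / p $ i) \<le> 1 + C \<longrightarrow> q \<le> (1 / \<epsilon>) *\<^sub>R p
      \<longrightarrow> (\<Sum>i\<in>UNIV. q $ i * (a i \<bullet> v)) \<le> \<delta>"
  shows "\<exists>w s \<beta> \<eta> l. (w, s, \<beta>, \<eta>, l) \<in> chi_feasible a v \<and>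
    \<beta> + 1 / \<epsilon> * (\<eta> + l * C + 2 * l - 2 * (\<Sum>i\<in>UNIV. ph $ i * s $ i)) \<le> \<delta>"
proof -
  have ph0: "0 \<le> ph $ i" for i using ph by (simp add: prob_simplex_def less_eq_vec_def)
  \<comment> \<open>Any \<open>\<theta> < 1\<close> with \<open>1 / \<theta> < 1 + C\<close> serves, since \<open>\<Sum>ph\<^sup>2/p0 \<le> 1 / \<theta>\<close>.\<close>
  define \<theta> where "\<theta> = 1 / (1 + C / 2)"
  have th: "0 < \<theta>" "\<theta> < 1" "1 / \<theta> < 1 + C" using \<open>0 < C\<close> by (auto simp: \<theta>_def)
  obtain p0 where p0: "p0 \<in> prob_simplex" "p0 \<in> pos_orthant" "\<And>i. \<theta> * ph $ i \<le> p0 $ i"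
    using slater_point[OF ph th(1,2)] by blast
  have "(\<Sum>i\<in>UNIV. (ph $ i)\<^sup>2 / p0 $ i) \<le> (\<Sum>i\<in>UNIV. 1 / \<theta> * ph $ i)"
  proof (rule sum_mono)
    fix i
    have "ph $ i * (\<theta> * ph $ i) \<le> ph $ i * p0 $ i" using p0(3) ph0 by (intro mult_left_mono)
    then show "(ph $ i)\<^sup>2 / p0 $ i \<le> 1 / \<theta> * ph $ i"
      using p0(2) th by (simp add: pos_orthant_def field_simps power2_eq_square)
  qed
  also have "\<dots> = 1 / \<theta>"
    using ph by (simp add: prob_simplex_def flip: sum_distrib_left sum_divide_distrib)
  also note th(3)
  finally have g0: "(\<Sum>i\<in>UNIV. (ph $ i)\<^sup>2 / p0 $ i) < 1 + C" .
  from separable_lagrange_multipliers[OF eps convex_on_chi_divergence p0(1,2) g0 ub]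
  obtain w :: "real^'n" and \<beta> \<eta> l where w: "0 \<le> w" "0 \<le> l" "\<forall>i. a i \<bullet> v - w $ i \<le> \<beta>"
    and L: "\<forall>p\<in>pos_orthant. (\<Sum>i\<in>UNIV. (w $ i - \<eta>) * p $ i - l * ((ph $ i)\<^sup>2 / p $ i))
       \<le> \<epsilon> * (\<delta> - \<beta>) - \<eta> - l * (1 + C)" by blast
  let ?\<phi> = "\<lambda>i x. (w $ i - \<eta>) * x - l * ((ph $ i)\<^sup>2 / x)"
  let ?B = "\<epsilon> * (\<delta> - \<beta>) - \<eta> - l * (1 + C)"
  note bd = bspec[OF L]
  have w_le: "w $ i \<le> \<eta>" for i
  proof -
    obtain K where K: "\<And>x. 0 < x \<Longrightarrow> ?\<phi> i x \<le> K" using separable_bound[of ?\<phi>, OF bd] by blast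
    have "(w $ i - \<eta>) * x \<le> K + l * (ph $ i)\<^sup>2" if "1 \<le> x" for x
    proof -
      have "(ph $ i)\<^sup>2 / x \<le> (ph $ i)\<^sup>2 / 1" using that by (intro divide_left_mono) auto
      then have "l * ((ph $ i)\<^sup>2 / x) \<le> l * (ph $ i)\<^sup>2" using w(2) by (intro mult_left_mono) auto
      then show ?thesis using K[of x] that by simp
    qed
    then have "w $ i - \<eta> \<le> 0" by (rule slope_nonpos_of_bounded)
    then show ?thesis by simp
  qed
  have sup: "(\<Sum>i\<in>UNIV. - 2 * ph $ i * sqrt (l * (\<eta> - w $ i))) \<le> ?B"
  proof (rule separable_sup_le[of ?\<phi>, OF bd])
    fix i and e :: real assume "0 < e"
    then show "\<exists>x>0. - 2 * ph $ i * sqrt (l * (\<eta> - w $ i)) - e \<le> ?\<phi> i x"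
      using chi_conjugate[of l "\<eta> - w $ i" "ph $ i" e] w(2) w_le[of i] ph0[of i] by simp
  qed
  let ?s = "\<chi> i. sqrt (l * (\<eta> - w $ i))"
  show ?thesis
  proof (intro exI conjI)
    have "norm (2 * ?s $ i, w $ i - (\<eta> - l)) \<le> 2 * l - w $ i + (\<eta> - l)" for i
    proof -
      have "(2 * ?s $ i)\<^sup>2 + (w $ i - (\<eta> - l))\<^sup>2 = (l + (\<eta> - w $ i))\<^sup>2"
        using w(2) w_le[of i] by (simp add: power_mult_distrib) (simp add: power2_eq_square algebra_simps)
      then have "norm (2 * ?s $ i, w $ i - (\<eta> - l)) = \<bar>l + (\<eta> - w $ i)\<bar>"
        unfolding norm_Pair real_norm_def power2_abs by simp
      then show ?thesis using w(2) w_le[of i] by simp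
    qed
    then show "(w, ?s, \<beta>, \<eta> - l, l) \<in> chi_feasible a v"
      using w w_le by (auto simp: chi_feasible_def less_eq_vec_def)
    have "(\<Sum>i\<in>UNIV. - 2 * ph $ i * sqrt (l * (\<eta> - w $ i))) = - 2 * (\<Sum>i\<in>UNIV. ph $ i * ?s $ i)"
      unfolding sum_distrib_left by (simp add: mult.assoc)
    with sup have "(\<eta> - l) + l * C + 2 * l - 2 * (\<Sum>i\<in>UNIV. ph $ i * ?s $ i) \<le> \<epsilon> * (\<delta> - \<beta>)"
      by (simp add: algebra_simps)
    then have "1 / \<epsilon> * ((\<eta> - l) + l * C + 2 * l - 2 * (\<Sum>i\<in>UNIV. ph $ i * ?s $ i)) \<le> 1 / \<epsilon> * (\<epsilon> * (\<delta> - \<beta>))"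
      using eps by (intro mult_left_mono) auto
    then show "\<beta> + 1 / \<epsilon> * ((\<eta> - l) + l * C + 2 * l - 2 * (\<Sum>i\<in>UNIV. ph $ i * ?s $ i)) \<le> \<delta>"
      using eps by simp
  qed
qed

lemma self_mem_conf_region_chi:
  fixes ph :: "real^'n"
  assumes "0 < \<alpha>" "\<alpha> < 1" "ph \<in> prob_simplex"
  shows "ph \<in> conf_region_chi \<alpha> N ph"
proof -
  have "(\<Sum>i\<in>UNIV. (ph $ i)\<^sup>2 / ph $ i) = 1"
    using assms by (simp add: prob_simplex_def power2_eq_square)
  moreover have "0 \<le> chi_square_quantile (CARD('n) - 1) (1 - \<alpha>) / real N"
    using chi_square_quantile_nonneg[of "1 - \<alpha>"] assms by simp
  ultimately show ?thesis using assms by (simp add: conf_region_chi_iff)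
qed

lemma singleton_index_expectation:
  fixes ph :: "real^'n" and a :: "'n \<Rightarrow> 'b::real_inner"
  assumes "CARD('n) = 1" "ph \<in> prob_simplex"
  shows "a i \<bullet> v = (\<Sum>j\<in>UNIV. ph $ j * (a j \<bullet> v))"
proof -
  have U: "UNIV = {i}" using assms(1) by (metis UNIV_I card_1_singletonE singletonD)
  have "ph $ i = 1" using assms(2) unfolding prob_simplex_def U by simp
  then show ?thesis unfolding U by simp
qed

text \<open>Strong duality needs a positive quantile, that is, \<open>n > 1\<close>. For \<open>n = 1\<close> the quantile is that of
  the point mass at \<open>0\<close>, and the confidence region has no strictly feasible point; but there the
  uncertainty set is the single point \<open>a i\<close>, and the multipliers vanish except \<open>\<beta> = a i \<bullet> v\<close>.\<close>

theorem chi_support_fun_is_minimum: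
  fixes ph :: "real^'n" and a :: "'n \<Rightarrow> 'b::real_inner"
  assumes \<alpha>: "0 < \<alpha>" "\<alpha> < 1" and "0 < N" and ph: "ph \<in> prob_simplex" and eps: "0 < \<epsilon>" "\<epsilon> < 1"
  shows "is_minimum (chi_objective \<alpha> N ph \<epsilon>) (chi_feasible a v)
    (support_fun (uncertainty_set a (conf_region_chi \<alpha> N ph) \<epsilon>) v)"
proof -
  let ?R = "conf_region_chi \<alpha> N ph"
  define C where "C = chi_square_quantile (CARD('n) - 1) (1 - \<alpha>) / real N"
  have obj: "chi_objective \<alpha> N ph \<epsilon> (w, s, \<beta>, \<eta>, l)
      = ereal (\<beta> + 1 / \<epsilon> * (\<eta> + l * C + 2 * l - 2 * (\<Sum>i\<in>UNIV. ph $ i * s $ i)))" for w s \<beta> \<eta> l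
    by (simp add: chi_objective_def C_def)
  have self: "ph \<in> ?R" by (rule self_mem_conf_region_chi[OF \<alpha> ph])
  have "?R \<subseteq> prob_simplex" by (auto simp: conf_region_chi_def)
  from support_fun_uncertainty_set[OF this self eps, of a v]
  obtain \<delta> where \<delta>: "support_fun (uncertainty_set a ?R \<epsilon>) v = ereal \<delta>"
    and ub: "\<And>q p. q \<in> prob_simplex \<Longrightarrow> p \<in> ?R \<Longrightarrow> q \<le> (1 / \<epsilon>) *\<^sub>R p
       \<Longrightarrow> (\<Sum>j\<in>UNIV. q $ j * (a j \<bullet> v)) \<le> \<delta>" by blast
  have weak: "support_fun (uncertainty_set a ?R \<epsilon>) v \<le> chi_objective \<alpha> N ph \<epsilon> x"
    if "x \<in> chi_feasible a v" for x
  proof (rule support_fun_uncertainty_set_le)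
    fix q p assume *: "q \<in> prob_simplex" "p \<in> ?R" "q \<le> (1 / \<epsilon>) *\<^sub>R p"
    obtain w s \<beta> \<eta> l where x: "x = (w, s, \<beta>, \<eta>, l)" by (metis prod.exhaust)
    show "ereal (\<Sum>j\<in>UNIV. q $ j * (a j \<bullet> v)) \<le> chi_objective \<alpha> N ph \<epsilon> x"
      unfolding x obj ereal_less_eq
      using * that[unfolded x] eps ph
      by (intro chi_weak_duality) (auto simp: conf_region_chi_iff C_def)
  qed
  show ?thesis
  proof (cases "CARD('n) = 1")
    case True
    let ?i = "undefined :: 'n"
    let ?x = "(0 :: real^'n, 0 :: real^'n, a ?i \<bullet> v, 0 :: real, 0 :: real)"
    have eq: "a i \<bullet> v = (\<Sum>j\<in>UNIV. ph $ j * (a j \<bullet> v))" for i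
      by (rule singleton_index_expectation[OF True ph])
    have le: "a i \<bullet> v \<le> a ?i \<bullet> v" for i
      by (simp only: eq[of i] eq[of ?i] order_refl)
    show ?thesis
    proof (rule is_minimumI[where xm = ?x])
      show "?x \<in> chi_feasible a v"
        using le by (simp add: chi_feasible_def less_eq_vec_def)
      show "chi_objective \<alpha> N ph \<epsilon> ?x \<le> support_fun (uncertainty_set a ?R \<epsilon>) v"
        unfolding obj \<delta> using ub[OF ph self prob_simplex_le_scaled[OF ph eps]] eq[of ?i] by simp
    qed (rule weak)
  next
    case False
    then have "0 < CARD('n) - 1" using zero_less_card_finite[where 'a = 'n] by linarith
    then have "0 < C"
      using chi_square_quantile_pos[of "1 - \<alpha>"] \<alpha> \<open>0 < N\<close> unfolding C_def by simp
    have ub': "\<forall>q\<in>prob_simplex. \<forall>p\<in>prob_simplex \<inter> pos_orthant.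
      (\<Sum>i\<in>UNIV. (ph $ i)\<^sup>2 / p $ i) \<le> 1 + C \<longrightarrow> q \<le> (1 / \<epsilon>) *\<^sub>R p
      \<longrightarrow> (\<Sum>i\<in>UNIV. q $ i * (a i \<bullet> v)) \<le> \<delta>"
    proof (intro ballI impI)
      fix q p :: "real^'n"
      assume *: "q \<in> prob_simplex" "p \<in> prob_simplex \<inter> pos_orthant"
        "(\<Sum>i\<in>UNIV. (ph $ i)\<^sup>2 / p $ i) \<le> 1 + C" "q \<le> (1 / \<epsilon>) *\<^sub>R p"
      have "p $ i \<noteq> 0" for i
        using *(2) less_imp_neq[of 0 "p $ i"] by (auto simp: pos_orthant_def)
      then have "p \<in> ?R" using * ph by (auto simp: conf_region_chi_iff C_def)
      with * show "(\<Sum>i\<in>UNIV. q $ i * (a i \<bullet> v)) \<le> \<delta>" by (intro ub)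
    qed
    from chi_dual_attained[OF eps ph \<open>0 < C\<close> ub']
    obtain w s \<beta> \<eta> l where feas: "(w, s, \<beta>, \<eta>, l) \<in> chi_feasible a v"
      and le: "\<beta> + 1 / \<epsilon> * (\<eta> + l * C + 2 * l - 2 * (\<Sum>i\<in>UNIV. ph $ i * s $ i)) \<le> \<delta>"
      by blast
    show ?thesis
    proof (rule is_minimumI[OF weak feas])
      show "chi_objective \<alpha> N ph \<epsilon> (w, s, \<beta>, \<eta>, l) \<le> support_fun (uncertainty_set a ?R \<epsilon>) v"
        unfolding obj \<delta> using le by simp
    qed
  qed
qed

section \<open>The region of the G test\<close>

lemma conf_region_G_iff:
  fixes ph p :: "real^'n"
  shows "p \<in> conf_region_G \<alpha> N ph \<longleftrightarrow> p \<in> prob_simplex \<and> (\<forall>i. p $ i = 0 \<longrightarrow> ph $ i = 0)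
    \<and> (\<Sum>i\<in>UNIV. ph $ i * ln (ph $ i / p $ i))
      \<le> chi_square_quantile (CARD('n) - 1) (1 - \<alpha>) / (2 * real N)"
  unfolding conf_region_G_def by (auto simp: rel_entropy_le_iff)

text \<open>The finite part of \<open>G_term\<close>, so that real arithmetic applies wherever no term is infinite.\<close>

definition G_term_real :: "real \<Rightarrow> real \<Rightarrow> real \<Rightarrow> real" where
  "G_term_real l h t = (if l = 0 \<or> h = 0 then 0 else - l * h * ln (1 - t / l))"

lemma G_term_eq:
  "G_term l h t = (if l \<noteq> 0 \<and> h \<noteq> 0 \<and> \<not> t < l then \<infinity> else ereal (G_term_real l h t))"
  by (simp add: G_term_def G_term_real_def zero_ereal_def)

lemma G_objective_eq:
  fixes ph w :: "real^'n"
  shows "G_objective \<alpha> N ph \<epsilon> (w, \<beta>, \<eta>, l) =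
    ereal \<beta> + ereal (1 / \<epsilon>) *
      (ereal (\<eta> + l * (chi_square_quantile (CARD('n) - 1) (1 - \<alpha>) / (2 * real N)))
        + (if \<exists>i. l \<noteq> 0 \<and> ph $ i \<noteq> 0 \<and> \<not> w $ i - \<eta> < l then \<infinity>
           else ereal (\<Sum>i\<in>UNIV. G_term_real l (ph $ i) (w $ i - \<eta>))))"
  unfolding G_objective_def by (simp add: G_term_eq sum_ereal_if)

text \<open>For positive \<open>l, h, p\<close> this is \<open>ln x \<le> x - 1\<close> at \<open>x = p (1 - t / l) / h\<close>, multiplied by \<open>l h\<close>.
  The terms \<open>l (p - h)\<close> cancel on summation.\<close>

lemma G_young:
  fixes p h t l :: real
  assumes "0 \<le> p" "0 \<le> h" "0 \<le> l" "t \<le> l" and "p = 0 \<longrightarrow> h = 0"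
    and fin: "l = 0 \<or> h = 0 \<or> t < l"
  shows "p * t \<le> l * (p - h) + l * (h * ln (h / p)) + G_term_real l h t"
proof (cases "l = 0 \<or> h = 0")
  case True
  then show ?thesis
    using assms mult_left_mono[of t l p] mult_nonneg_nonpos[of p t]
    by (auto simp: G_term_real_def mult.commute)
next
  case False
  with assms have pos: "0 < l" "0 < h" "0 < p" "t < l" by auto
  define y where "y = 1 - t / l"
  have y: "0 < y" "l * y = l - t" using pos by (auto simp: y_def field_simps)
  have "ln (p * y / h) \<le> p * y / h - 1" using pos y by (intro ln_le_minus_one) auto
  then have "ln p + ln y - ln h \<le> p * y / h - 1"
    using pos y by (simp add: ln_div ln_mult)
  then have "l * h * (ln p + ln y - ln h) \<le> l * h * (p * y / h - 1)"
    using pos by (intro mult_left_mono) auto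
  also have "\<dots> = p * (l * y) - l * h" using pos by (simp add: field_simps)
  finally have "l * h * (ln p + ln y - ln h) \<le> p * (l - t) - l * h" unfolding y(2) .
  moreover have "G_term_real l h t = - l * h * ln y"
    using False by (simp add: G_term_real_def y_def)
  ultimately show ?thesis using pos by (simp add: ln_div algebra_simps)
qed

lemma G_weak_duality:
  fixes ph p q w :: "real^'n" and a :: "'n \<Rightarrow> 'b::real_inner"
  assumes "0 < \<epsilon>" "ph \<in> prob_simplex" "q \<in> prob_simplex" "p \<in> prob_simplex"
    and "q \<le> (1 / \<epsilon>) *\<^sub>R p" and supp: "\<forall>i. p $ i = 0 \<longrightarrow> ph $ i = 0"
    and C: "(\<Sum>i\<in>UNIV. ph $ i * ln (ph $ i / p $ i)) \<le> C"
    and feas: "(w, \<beta>, \<eta>, l) \<in> G_feasible a v"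
    and fin: "\<forall>i. l = 0 \<or> ph $ i = 0 \<or> w $ i - \<eta> < l"
  shows "(\<Sum>i\<in>UNIV. q $ i * (a i \<bullet> v))
    \<le> \<beta> + 1 / \<epsilon> * (\<eta> + l * C + (\<Sum>i\<in>UNIV. G_term_real l (ph $ i) (w $ i - \<eta>)))"
proof -
  let ?G = "\<Sum>i\<in>UNIV. G_term_real l (ph $ i) (w $ i - \<eta>)"
  have "(\<Sum>i\<in>UNIV. p $ i * (w $ i - \<eta>))
      \<le> (\<Sum>i\<in>UNIV. l * (p $ i - ph $ i) + l * (ph $ i * ln (ph $ i / p $ i))
           + G_term_real l (ph $ i) (w $ i - \<eta>))"
  proof (rule sum_mono)
    fix i
    show "p $ i * (w $ i - \<eta>) \<le> l * (p $ i - ph $ i) + l * (ph $ i * ln (ph $ i / p $ i))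
           + G_term_real l (ph $ i) (w $ i - \<eta>)"
      using assms(2,4) supp feas fin
      by (intro G_young) (auto simp: G_feasible_def prob_simplex_def less_eq_vec_def algebra_simps)
  qed
  also have "\<dots> = l * (\<Sum>i\<in>UNIV. ph $ i * ln (ph $ i / p $ i)) + ?G"
    unfolding sum.distrib sum_distrib_left[symmetric] sum_subtractf
    using assms(2,4) by (simp add: prob_simplex_def)
  also have "\<dots> \<le> l * C + ?G"
    using C feas by (intro add_right_mono mult_left_mono) (auto simp: G_feasible_def)
  also have "(\<Sum>i\<in>UNIV. p $ i * (w $ i - \<eta>)) = (\<Sum>i\<in>UNIV. p $ i * w $ i) - \<eta>"
    using assms(4)
    by (simp add: prob_simplex_def sum_subtractf right_diff_distrib flip: sum_distrib_right)
  finally have "(\<Sum>i\<in>UNIV. p $ i * w $ i) \<le> \<eta> + l * C + ?G" by simp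
  then have "\<beta> + 1 / \<epsilon> * (\<Sum>i\<in>UNIV. p $ i * w $ i) \<le> \<beta> + 1 / \<epsilon> * (\<eta> + l * C + ?G)"
    using \<open>0 < \<epsilon>\<close> by (intro add_left_mono mult_left_mono) auto
  moreover have "(\<Sum>i\<in>UNIV. q $ i * (a i \<bullet> v)) \<le> \<beta> + 1 / \<epsilon> * (\<Sum>i\<in>UNIV. p $ i * w $ i)"
    using assms(3,5) feas by (intro expectation_le_scaled) (auto simp: G_feasible_def)
  ultimately show ?thesis by linarith
qed

text \<open>As for Pearson's region, with the shift \<open>\<eta> - l\<close> now absorbing the terms \<open>- l h\<close> of the conjugates,
  whose sum is \<open>- l\<close>. A term with \<open>w i = \<eta>\<close> and \<open>l, ph i > 0\<close> would make the one-variable problem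
  unbounded, so no term of the dual objective is infinite.\<close>

lemma G_dual_attained:
  fixes ph :: "real^'n" and a :: "'n \<Rightarrow> 'b::real_inner"
  assumes eps: "0 < \<epsilon>" "\<epsilon> < 1" and ph: "ph \<in> prob_simplex" and "0 < C"
    and ub: "\<forall>q\<in>prob_simplex. \<forall>p\<in>prob_simplex \<inter> pos_orthant.
      (\<Sum>i\<in>UNIV. ph $ i * ln (ph $ i / p $ i)) \<le> C \<longrightarrow> q \<le> (1 / \<epsilon>) *\<^sub>R p
      \<longrightarrow> (\<Sum>i\<in>UNIV. q $ i * (a i \<bullet> v)) \<le> \<delta>"
  shows "\<exists>w \<beta> \<eta> l. (w, \<beta>, \<eta>, l) \<in> G_feasible a v \<and>
    (\<forall>i. l = 0 \<or> ph $ i = 0 \<or> w $ i - \<eta> < l) \<and>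
    \<beta> + 1 / \<epsilon> * (\<eta> + l * C + (\<Sum>i\<in>UNIV. G_term_real l (ph $ i) (w $ i - \<eta>))) \<le> \<delta>"
proof -
  have ph0: "0 \<le> ph $ i" for i using ph by (simp add: prob_simplex_def less_eq_vec_def)
  \<comment> \<open>Any \<open>\<theta> < 1\<close> with \<open>- ln \<theta> < C\<close> serves, since the divergence of \<open>p0\<close> is at most \<open>- ln \<theta>\<close>.\<close>
  define \<theta> where "\<theta> = exp (- C / 2)"
  have th: "0 < \<theta>" "\<theta> < 1" "- ln \<theta> < C" using \<open>0 < C\<close> by (auto simp: \<theta>_def)
  obtain p0 where p0: "p0 \<in> prob_simplex" "p0 \<in> pos_orthant" "\<And>i. \<theta> * ph $ i \<le> p0 $ i"
    using slater_point[OF ph th(1,2)] by blast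
  have "(\<Sum>i\<in>UNIV. ph $ i * ln (ph $ i / p0 $ i)) \<le> (\<Sum>i\<in>UNIV. ph $ i * (- ln \<theta>))"
  proof (rule sum_mono)
    fix i
    show "ph $ i * ln (ph $ i / p0 $ i) \<le> ph $ i * (- ln \<theta>)"
    proof (cases "ph $ i = 0")
      case False
      then have pos: "0 < ph $ i" "0 < p0 $ i" using ph0[of i] p0(2) by (auto simp: pos_orthant_def)
      then have "ln (\<theta> * ph $ i) \<le> ln (p0 $ i)" using p0(3)[of i] th by simp
      then have "ln (ph $ i / p0 $ i) \<le> - ln \<theta>" using pos th by (simp add: ln_mult ln_div)
      then show ?thesis using pos by (intro mult_left_mono) auto
    qed simp
  qed
  also have "\<dots> = - ln \<theta>"
    unfolding sum_distrib_right[symmetric] using ph by (simp add: prob_simplex_def)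
  also note th(3)
  finally have g0: "(\<Sum>i\<in>UNIV. ph $ i * ln (ph $ i / p0 $ i)) < C" .
  from separable_lagrange_multipliers[OF eps convex_on_log_divergence[OF ph0] p0(1,2) g0 ub]
  obtain w :: "real^'n" and \<beta> \<eta> l where w: "0 \<le> w" "0 \<le> l" "\<forall>i. a i \<bullet> v - w $ i \<le> \<beta>"
    and L: "\<forall>p\<in>pos_orthant. (\<Sum>i\<in>UNIV. (w $ i - \<eta>) * p $ i - l * (ph $ i * ln (ph $ i / p $ i)))
       \<le> \<epsilon> * (\<delta> - \<beta>) - \<eta> - l * C" by blast
  let ?\<phi> = "\<lambda>i x. (w $ i - \<eta>) * x - l * (ph $ i * ln (ph $ i / x))"
  let ?B = "\<epsilon> * (\<delta> - \<beta>) - \<eta> - l * C"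
  note bd = bspec[OF L]
  have w_le: "w $ i \<le> \<eta>" for i
  proof -
    obtain K where K: "\<And>x. 0 < x \<Longrightarrow> ?\<phi> i x \<le> K" using separable_bound[of ?\<phi>, OF bd] by blast
    have "(w $ i - \<eta>) * x \<le> K + l * (ph $ i * ln (ph $ i))" if "1 \<le> x" for x
    proof -
      have "ph $ i * ln (ph $ i / x) \<le> ph $ i * ln (ph $ i)"
      proof (cases "ph $ i = 0")
        case False
        then have "ln (ph $ i / x) \<le> ln (ph $ i)" using that ph0[of i] by (simp add: ln_div)
        then show ?thesis using ph0[of i] by (rule mult_left_mono)
      qed simp
      then have "l * (ph $ i * ln (ph $ i / x)) \<le> l * (ph $ i * ln (ph $ i))"
        using w(2) by (rule mult_left_mono)
      then show ?thesis using K[of x] that by simp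
    qed
    then have "w $ i - \<eta> \<le> 0" by (rule slope_nonpos_of_bounded)
    then show ?thesis by simp
  qed
  have fin: "l = 0 \<or> ph $ i = 0 \<or> w $ i < \<eta>" for i
  proof (rule ccontr)
    assume "\<not> (l = 0 \<or> ph $ i = 0 \<or> w $ i < \<eta>)"
    then have *: "0 < l" "0 < ph $ i" "w $ i = \<eta>" using w(2) ph0[of i] w_le[of i] by auto
    obtain K where K: "\<And>x. 0 < x \<Longrightarrow> ?\<phi> i x \<le> K" using separable_bound[of ?\<phi>, OF bd] by blast
    \<comment> \<open>Solves \<open>\<phi> i x = K + 1\<close>, as the linear term vanishes.\<close>
    define x where "x = ph $ i * exp ((K + 1) / (l * ph $ i))"
    have "ln (ph $ i / x) = - ((K + 1) / (l * ph $ i))"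
      using * by (simp add: x_def ln_div ln_mult)
    then have "?\<phi> i x = K + 1" using * by (simp add: field_simps)
    moreover have "0 < x" using * by (simp add: x_def)
    ultimately show False using K[of x] by simp
  qed
  let ?z = "\<lambda>i. if l = 0 \<or> ph $ i = 0 then 0 else - l * ph $ i * ln ((\<eta> - w $ i) / l) - l * ph $ i"
  have sup: "(\<Sum>i\<in>UNIV. ?z i) \<le> ?B"
  proof (rule separable_sup_le[of ?\<phi>, OF bd])
    fix i and e :: real assume "0 < e"
    then show "\<exists>x>0. ?z i - e \<le> ?\<phi> i x"
      using G_conjugate[of l "\<eta> - w $ i" "ph $ i" e] w(2) w_le[of i] ph0[of i] fin[of i] by simp
  qed
  show ?thesis
  proof (intro exI conjI allI)
    show "(w, \<beta>, \<eta> - l, l) \<in> G_feasible a v"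
      using w w_le by (auto simp: G_feasible_def less_eq_vec_def)
    show "l = 0 \<or> ph $ i = 0 \<or> w $ i - (\<eta> - l) < l" for i using fin[of i] by auto
    have "?z i = G_term_real l (ph $ i) (w $ i - (\<eta> - l)) - l * ph $ i" for i
    proof (cases "l = 0")
      case False
      then have "1 - (w $ i - (\<eta> - l)) / l = (\<eta> - w $ i) / l" by (simp add: field_simps)
      then show ?thesis by (simp add: G_term_real_def)
    qed (simp add: G_term_real_def)
    then have "(\<Sum>i\<in>UNIV. ?z i)
        = (\<Sum>i\<in>UNIV. G_term_real l (ph $ i) (w $ i - (\<eta> - l))) - l * (\<Sum>i\<in>UNIV. ph $ i)"
      by (simp only: sum_subtractf sum_distrib_left)
    with sup ph have "(\<eta> - l) + l * C + (\<Sum>i\<in>UNIV. G_term_real l (ph $ i) (w $ i - (\<eta> - l))) \<le> \<epsilon> * (\<delta> - \<beta>)"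
      by (simp add: prob_simplex_def)
    then have "1 / \<epsilon> * ((\<eta> - l) + l * C + (\<Sum>i\<in>UNIV. G_term_real l (ph $ i) (w $ i - (\<eta> - l))))
        \<le> 1 / \<epsilon> * (\<epsilon> * (\<delta> - \<beta>))"
      using eps by (intro mult_left_mono) auto
    then show "\<beta> + 1 / \<epsilon> * ((\<eta> - l) + l * C + (\<Sum>i\<in>UNIV. G_term_real l (ph $ i) (w $ i - (\<eta> - l)))) \<le> \<delta>"
      using eps by simp
  qed
qed

lemma self_mem_conf_region_G:
  fixes ph :: "real^'n"
  assumes "0 < \<alpha>" "\<alpha> < 1" "ph \<in> prob_simplex"
  shows "ph \<in> conf_region_G \<alpha> N ph"
proof -
  have "(\<Sum>i\<in>UNIV. ph $ i * ln (ph $ i / ph $ i)) = 0" by (rule sum.neutral) simp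
  moreover have "0 \<le> chi_square_quantile (CARD('n) - 1) (1 - \<alpha>) / (2 * real N)"
    using chi_square_quantile_nonneg[of "1 - \<alpha>"] assms by simp
  ultimately show ?thesis using assms by (simp only: conf_region_G_iff) simp
qed

theorem G_support_fun_is_minimum:
  fixes ph :: "real^'n" and a :: "'n \<Rightarrow> 'b::real_inner"
  assumes \<alpha>: "0 < \<alpha>" "\<alpha> < 1" and "0 < N" and ph: "ph \<in> prob_simplex" and eps: "0 < \<epsilon>" "\<epsilon> < 1"
  shows "is_minimum (G_objective \<alpha> N ph \<epsilon>) (G_feasible a v)
    (support_fun (uncertainty_set a (conf_region_G \<alpha> N ph) \<epsilon>) v)"
proof -
  let ?R = "conf_region_G \<alpha> N ph"
  define C where "C = chi_square_quantile (CARD('n) - 1) (1 - \<alpha>) / (2 * real N)"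
  have obj: "G_objective \<alpha> N ph \<epsilon> (w, \<beta>, \<eta>, l)
      = (if \<forall>i. l = 0 \<or> ph $ i = 0 \<or> w $ i - \<eta> < l
         then ereal (\<beta> + 1 / \<epsilon> * (\<eta> + l * C + (\<Sum>i\<in>UNIV. G_term_real l (ph $ i) (w $ i - \<eta>))))
         else \<infinity>)" for w \<beta> \<eta> l
    unfolding G_objective_eq C_def[symmetric] using eps by simp
  have self: "ph \<in> ?R" by (rule self_mem_conf_region_G[OF \<alpha> ph])
  have "?R \<subseteq> prob_simplex" by (auto simp: conf_region_G_def)
  from support_fun_uncertainty_set[OF this self eps, of a v]
  obtain \<delta> where \<delta>: "support_fun (uncertainty_set a ?R \<epsilon>) v = ereal \<delta>"
    and ub: "\<And>q p. q \<in> prob_simplex \<Longrightarrow> p \<in> ?R \<Longrightarrow> q \<le> (1 / \<epsilon>) *\<^sub>R p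
       \<Longrightarrow> (\<Sum>j\<in>UNIV. q $ j * (a j \<bullet> v)) \<le> \<delta>" by blast
  have weak: "support_fun (uncertainty_set a ?R \<epsilon>) v \<le> G_objective \<alpha> N ph \<epsilon> x"
    if "x \<in> G_feasible a v" for x
  proof (rule support_fun_uncertainty_set_le)
    fix q p assume *: "q \<in> prob_simplex" "p \<in> ?R" "q \<le> (1 / \<epsilon>) *\<^sub>R p"
    obtain w \<beta> \<eta> l where x: "x = (w, \<beta>, \<eta>, l)" by (metis prod.exhaust)
    show "ereal (\<Sum>j\<in>UNIV. q $ j * (a j \<bullet> v)) \<le> G_objective \<alpha> N ph \<epsilon> x"
    proof (cases "\<forall>i. l = 0 \<or> ph $ i = 0 \<or> w $ i - \<eta> < l")
      case True
      have "(\<Sum>j\<in>UNIV. q $ j * (a j \<bullet> v))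
          \<le> \<beta> + 1 / \<epsilon> * (\<eta> + l * C + (\<Sum>i\<in>UNIV. G_term_real l (ph $ i) (w $ i - \<eta>)))"
        using * that[unfolded x] eps ph True
        by (intro G_weak_duality) (auto simp: conf_region_G_iff C_def)
      then show ?thesis unfolding x obj using True by simp
    next
      case False
      show ?thesis unfolding x obj if_not_P[OF False] by simp
    qed
  qed
  show ?thesis
  proof (cases "CARD('n) = 1")
    case True
    let ?i = "undefined :: 'n"
    let ?x = "(0 :: real^'n, a ?i \<bullet> v, 0 :: real, 0 :: real)"
    have eq: "a i \<bullet> v = (\<Sum>j\<in>UNIV. ph $ j * (a j \<bullet> v))" for i
      by (rule singleton_index_expectation[OF True ph])
    have le: "a i \<bullet> v \<le> a ?i \<bullet> v" for i
      by (simp only: eq[of i] eq[of ?i] order_refl)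
    show ?thesis
    proof (rule is_minimumI[where xm = ?x])
      show "?x \<in> G_feasible a v"
        using le by (simp add: G_feasible_def less_eq_vec_def)
      show "G_objective \<alpha> N ph \<epsilon> ?x \<le> support_fun (uncertainty_set a ?R \<epsilon>) v"
        unfolding obj \<delta> using ub[OF ph self prob_simplex_le_scaled[OF ph eps]] eq[of ?i]
        by (simp add: G_term_real_def)
    qed (rule weak)
  next
    case False
    then have "0 < CARD('n) - 1" using zero_less_card_finite[where 'a = 'n] by linarith
    then have "0 < C"
      using chi_square_quantile_pos[of "1 - \<alpha>"] \<alpha> \<open>0 < N\<close> unfolding C_def by simp
    have ub': "\<forall>q\<in>prob_simplex. \<forall>p\<in>prob_simplex \<inter> pos_orthant.
      (\<Sum>i\<in>UNIV. ph $ i * ln (ph $ i / p $ i)) \<le> C \<longrightarrow> q \<le> (1 / \<epsilon>) *\<^sub>R p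
      \<longrightarrow> (\<Sum>i\<in>UNIV. q $ i * (a i \<bullet> v)) \<le> \<delta>"
    proof (intro ballI impI)
      fix q p :: "real^'n"
      assume *: "q \<in> prob_simplex" "p \<in> prob_simplex \<inter> pos_orthant"
        "(\<Sum>i\<in>UNIV. ph $ i * ln (ph $ i / p $ i)) \<le> C" "q \<le> (1 / \<epsilon>) *\<^sub>R p"
      have "p $ i \<noteq> 0" for i
        using *(2) less_imp_neq[of 0 "p $ i"] by (auto simp: pos_orthant_def)
      then have "p \<in> ?R" using * by (auto simp: conf_region_G_iff C_def)
      with * show "(\<Sum>i\<in>UNIV. q $ i * (a i \<bullet> v)) \<le> \<delta>" by (intro ub)
    qed
    from G_dual_attained[OF eps ph \<open>0 < C\<close> ub']
    obtain w \<beta> \<eta> l where feas: "(w, \<beta>, \<eta>, l) \<in> G_feasible a v"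
      and fin: "\<forall>i. l = 0 \<or> ph $ i = 0 \<or> w $ i - \<eta> < l"
      and le: "\<beta> + 1 / \<epsilon> * (\<eta> + l * C + (\<Sum>i\<in>UNIV. G_term_real l (ph $ i) (w $ i - \<eta>))) \<le> \<delta>"
      by blast
    show ?thesis
    proof (rule is_minimumI[OF weak feas])
      show "G_objective \<alpha> N ph \<epsilon> (w, \<beta>, \<eta>, l) \<le> support_fun (uncertainty_set a ?R \<epsilon>) v"
        unfolding obj \<delta> using le fin by simp
    qed
  qed
qed

section \<open>The probabilistic guarantee\<close>

text \<open>Every point of \<open>- A\<close> has an open null neighbourhood. There may be uncountably many of them,
  but in a second countable space countably many already cover \<open>- A\<close>.\<close>

lemma measure_outside_closed_superset_of_support:
  fixes P :: "'a::{second_countable_topology} measure"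
  assumes "sets P = sets borel" "measure_support P \<subseteq> A" "closed A"
  shows "emeasure P (- A) = 0"
proof -
  define F where "F = {V. open V \<and> emeasure P V = 0}"
  have "- A \<subseteq> \<Union>F"
  proof
    fix x assume "x \<in> - A"
    then have "x \<notin> measure_support P" using assms by auto
    then show "x \<in> \<Union>F" by (auto simp: measure_support_def F_def)
  qed
  moreover obtain F' where F': "F' \<subseteq> F" "countable F'" "\<Union>F' = \<Union>F"
    using Lindelof[of F] by (auto simp: F_def)
  moreover have "\<Union>F' \<in> null_sets P"
  proof (rule null_sets_UN'[of F' "\<lambda>x. x", simplified])
    show "V \<in> null_sets P" if "V \<in> F'" for V
      using that F'(1) assms(1) by (auto simp: F_def null_sets_def)
  qed (fact F'(2))
  moreover have "- A \<in> sets P" using assms by auto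
  ultimately have "- A \<in> null_sets P" by (metis null_sets_subset)
  then show ?thesis by (rule null_setsD1)
qed

lemma concave_on_UNIV_borel_measurable:
  fixes g :: "'a::euclidean_space \<Rightarrow> real"
  assumes "concave_on UNIV g"
  shows "g \<in> borel_measurable borel"
proof -
  have "continuous_on UNIV (\<lambda>u. - g u)"
    using assms by (intro convex_on_continuous) (auto simp: concave_on_def)
  then have "continuous_on UNIV (\<lambda>u. - (- g u))" by (rule continuous_on_minus)
  then show ?thesis by (intro borel_measurable_continuous_onI) simp
qed

lemma concave_on_UNIV_Jensen:
  fixes g :: "'a::real_vector \<Rightarrow> real" and y :: "'n::finite \<Rightarrow> 'a"
  assumes "concave_on UNIV g" "(\<Sum>i\<in>UNIV. c i) = 1" "\<And>i. 0 \<le> c i"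
  shows "(\<Sum>i\<in>UNIV. c i * g (y i)) \<le> g (\<Sum>i\<in>UNIV. c i *\<^sub>R y i)"
proof -
  have "(\<lambda>u. - g u) (\<Sum>i\<in>UNIV. c i *\<^sub>R y i) \<le> (\<Sum>i\<in>UNIV. c i * (\<lambda>u. - g u) (y i))"
    using assms by (intro convex_on_sum[where C = UNIV]) (auto simp: concave_on_def)
  then show ?thesis by (simp add: sum_negf)
qed

text \<open>If \<open>f\<close> were positive with probability more than \<open>\<epsilon>\<close>, conditioning the true law on the atoms
  where \<open>f\<close> is positive would divide the masses by more than \<open>\<epsilon>\<close>. The conditional law would thus
  be an admissible \<open>q\<close>, and by Jensen's inequality \<open>f\<close> would be positive at its mean, a point of the
  uncertainty set.\<close>

lemma guarantee_of_mem_region: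
  fixes P :: "(real^'d) measure" and a :: "'n::finite \<Rightarrow> real^'d" and R :: "(real^'n) set"
  assumes "prob_space P" and sets: "sets P = sets borel" and "inj a"
    and supp: "measure_support P \<subseteq> range a"
    and mem: "(\<chi> i. measure P {a i}) \<in> R" "R \<subseteq> prob_simplex"
  shows "simultaneously_implies_guarantee TYPE('k::finite) P (uncertainty_set a R)"
  unfolding simultaneously_implies_guarantee_def implies_guarantee_def
proof (intro allI impI)
  interpret prob_space P by fact
  fix \<epsilon> :: real and x0 :: "real^'k" and f :: "real^'d \<Rightarrow> real^'k \<Rightarrow> real"
  assume eps: "0 < \<epsilon> \<and> \<epsilon> < 1" and conc: "\<forall>x. concave_on UNIV (\<lambda>u. f u x)"
    and U: "\<forall>u\<in>uncertainty_set a R \<epsilon>. f u x0 \<le> 0"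
  let ?g = "\<lambda>u. f u x0" and ?p = "\<lambda>i. measure P {a i}"
  have g: "concave_on UNIV ?g" using conc by simp
  have space: "space P = UNIV" using sets_eq_imp_space_eq[OF sets] by simp
  have meas: "?g \<in> borel_measurable P"
    using concave_on_UNIV_borel_measurable[OF g] measurable_cong_sets[OF sets refl] by blast
  define A where "A = {i. 0 < ?g (a i)}"
  define pA where "pA = (\<Sum>i\<in>A. ?p i)"
  have bad: "measure P {u \<in> space P. 0 < ?g u} = pA"
  proof -
    have closed: "closed (range a)" by (intro finite_imp_closed) simp
    have null: "emeasure P (- range a) = 0"
      using sets supp closed by (rule measure_outside_closed_superset_of_support)
    have "measure P {u \<in> space P. 0 < ?g u} = measure P (a ` A)"
    proof (rule measure_eq_AE)
      have "- range a \<in> null_sets P"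
        using null by (rule null_setsI) (use closed in \<open>simp add: sets borel_closed\<close>)
      then have "AE u in P. u \<notin> - range a" by (rule AE_not_in)
      then show "AE u in P. u \<in> {u \<in> space P. 0 < ?g u} \<longleftrightarrow> u \<in> a ` A"
        by eventually_elim (auto simp: A_def space)
      show "{u \<in> space P. 0 < ?g u} \<in> sets P" using meas by measurable
      show "a ` A \<in> sets P" unfolding sets by (intro borel_closed finite_imp_closed) simp
    qed
    also have "\<dots> = (\<Sum>u\<in>a ` A. measure P {u})"
      using sets by (intro finite_measure_eq_sum_singleton) auto
    also have "\<dots> = pA"
      unfolding pA_def using \<open>inj a\<close> by (subst sum.reindex) (auto intro: inj_on_subset)
    finally show ?thesis .
  qed
  have "pA \<le> \<epsilon>"
  proof (rule ccontr)
    assume "\<not> pA \<le> \<epsilon>"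
    then have pA: "\<epsilon> < pA" "0 < pA" using eps by auto
    \<comment> \<open>The law of \<open>u\<close> conditioned on \<open>f u x0 > 0\<close>.\<close>
    define q :: "real^'n" where "q = (\<chi> i. if i \<in> A then ?p i / pA else 0)"
    have q0: "0 \<le> q $ i" for i using pA by (simp add: q_def)
    have q1: "(\<Sum>i\<in>UNIV. q $ i) = 1"
    proof -
      have "(\<Sum>i\<in>UNIV. q $ i) = (\<Sum>i\<in>A. ?p i / pA)"
        unfolding q_def by (simp add: sum.If_cases)
      also have "\<dots> = 1" unfolding sum_divide_distrib[symmetric] using pA by (simp add: pA_def)
      finally show ?thesis .
    qed
    have "q $ i \<le> 1 / \<epsilon> * ?p i" for i
      using pA eps by (auto simp: q_def intro!: divide_left_mono)
    then have "q \<le> (1 / \<epsilon>) *\<^sub>R (\<chi> i. ?p i)" by (simp add: less_eq_vec_def)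
    moreover have "q \<in> prob_simplex" using q0 q1 by (simp add: prob_simplex_def less_eq_vec_def)
    ultimately have "(\<Sum>j\<in>UNIV. (q $ j) *\<^sub>R a j) \<in> uncertainty_set a R \<epsilon>"
      using mem unfolding uncertainty_set_def by blast
    with U have "?g (\<Sum>j\<in>UNIV. (q $ j) *\<^sub>R a j) \<le> 0" by blast
    with concave_on_UNIV_Jensen[OF g q1 q0, of a]
    have "(\<Sum>i\<in>UNIV. q $ i * ?g (a i)) \<le> 0" by linarith
    moreover have nn: "0 \<le> q $ i * ?g (a i)" for i
    proof (cases "i \<in> A")
      case True
      then show ?thesis using q0[of i] by (intro mult_nonneg_nonneg) (simp_all add: A_def)
    qed (simp add: q_def)
    ultimately have "(\<Sum>i\<in>UNIV. q $ i * ?g (a i)) = 0" by (intro antisym sum_nonneg) auto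
    then have zero: "q $ i * ?g (a i) = 0" for i using nn by (simp add: sum_nonneg_eq_0_iff)
    have "q $ i = 0" for i
      using zero[of i] by (cases "i \<in> A") (auto simp: A_def q_def)
    with q1 show False by simp
  qed
  moreover have "measure P {u \<in> space P. ?g u \<le> 0} = 1 - measure P {u \<in> space P. 0 < ?g u}"
  proof -
    have "{u \<in> space P. ?g u \<le> 0} = space P - {u \<in> space P. 0 < ?g u}" by auto
    moreover have "{u \<in> space P. 0 < ?g u} \<in> events" using meas by measurable
    ultimately show ?thesis by (simp add: prob_compl)
  qed
  ultimately show "1 - \<epsilon> \<le> measure P {u \<in> space P. ?g u \<le> 0}" using bad by simp
qed

section \<open>The empirical frequencies\<close>

lemma empirical_mem_prob_simplex:
  fixes a :: "'n::finite \<Rightarrow> 'b"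
  assumes "0 < N" "inj a" "\<And>j. j < N \<Longrightarrow> u j \<in> range a"
  shows "empirical a N u \<in> prob_simplex"
proof -
  have "(\<Sum>i\<in>UNIV. of_bool (u j = a i)) = (1::real)" if j: "j < N" for j
  proof -
    obtain i where i: "u j = a i" using assms(3)[OF j] by auto
    have "(\<Sum>k\<in>UNIV. of_bool (u j = a k)) = (\<Sum>k\<in>UNIV. of_bool (k = i) :: real)"
      using \<open>inj a\<close> i by (intro sum.cong) (auto simp: inj_eq)
    then show ?thesis by simp
  qed
  then have "(\<Sum>j<N. \<Sum>i\<in>UNIV. of_bool (u j = a i)) = real N" by simp
  then have "(\<Sum>i\<in>UNIV. \<Sum>j<N. of_bool (u j = a i)) = real N" by (subst sum.swap)
  then show ?thesis
    using \<open>0 < N\<close>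
    by (auto simp: empirical_def prob_simplex_def less_eq_vec_def simp flip: sum_divide_distrib
        intro!: divide_nonneg_nonneg sum_nonneg)
qed

text \<open>The empirical frequencies depend only on which of the finitely many events \<open>X j \<omega> = a i\<close>
  occur. Hence the event is measurable for an arbitrary predicate \<open>Q\<close>; this is essential, because
  the guarantee quantifies over all concave functions.\<close>

lemma empirical_event_measurable:
  fixes a :: "'n::finite \<Rightarrow> 'b::t1_space"
  assumes X: "\<And>j. j < N \<Longrightarrow> X j \<in> measurable M borel"
  shows "{\<omega> \<in> space M. Q (empirical a N (\<lambda>j. X j \<omega>))} \<in> sets M"
proof -
  \<comment> \<open>\<open>K \<omega>\<close> records which of the events \<open>X j \<omega> = a i\<close> occur; \<open>F\<close> recovers the frequencies
    from that record.\<close>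
  define F :: "(nat \<times> 'n) set \<Rightarrow> real^'n"
    where "F S = (\<chi> i. (1 / real N) * (\<Sum>j<N. of_bool ((j, i) \<in> S)))" for S
  define K where "K \<omega> = {(j, i). j < N \<and> X j \<omega> = a i}" for \<omega>
  have "empirical a N (\<lambda>j. X j \<omega>) = F (K \<omega>)" for \<omega>
    by (auto simp: empirical_def F_def K_def vec_eq_iff intro!: sum.cong)
  moreover have "K \<omega> \<in> Pow ({..<N} \<times> UNIV)" for \<omega> by (auto simp: K_def)
  ultimately have eq: "{\<omega> \<in> space M. Q (empirical a N (\<lambda>j. X j \<omega>))}
      = (\<Union>S\<in>{S \<in> Pow ({..<N} \<times> UNIV). Q (F S)}. {\<omega> \<in> space M. K \<omega> = S})"
    by auto
  have "{\<omega> \<in> space M. K \<omega> = S} \<in> sets M" if S: "S \<subseteq> {..<N} \<times> UNIV" for S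
  proof -
    have "{\<omega> \<in> space M. X j \<omega> = a i} \<in> sets M" if "j < N" for j i
    proof -
      have "X j -` {a i} \<inter> space M \<in> sets M"
        using X[OF that] by (rule measurable_sets) (simp add: borel_closed)
      also have "X j -` {a i} \<inter> space M = {\<omega> \<in> space M. X j \<omega> = a i}" by auto
      finally show ?thesis .
    qed
    then have "{\<omega> \<in> space M. (X j \<omega> = a i) = ((j, i) \<in> S)} \<in> sets M" if "j < N" for j i
      using that by (cases "(j, i) \<in> S") (auto intro: sets.sets_Collect_neg)
    then have "{\<omega> \<in> space M. \<forall>j\<in>{..<N}. \<forall>i\<in>UNIV. (X j \<omega> = a i) = ((j, i) \<in> S)} \<in> sets M"
      by (intro sets.sets_Collect_finite_All) auto
    also have "{\<omega> \<in> space M. \<forall>j\<in>{..<N}. \<forall>i\<in>UNIV. (X j \<omega> = a i) = ((j, i) \<in> S)}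
        = {\<omega> \<in> space M. K \<omega> = S}"
      using S by (auto simp: K_def)
    finally show ?thesis .
  qed
  then show ?thesis unfolding eq by (intro sets.finite_UN) auto
qed

lemma guarantee_probability:
  fixes P :: "(real^'d) measure" and a :: "'n::finite \<Rightarrow> real^'d"
    and R :: "real^'n \<Rightarrow> (real^'n) set"
  assumes "prob_space P" "sets P = sets borel" "inj a" "measure_support P \<subseteq> range a"
    and "prob_space M" and X: "\<And>j. j < N \<Longrightarrow> X j \<in> measurable M borel"
    and R: "\<And>ph. R ph \<subseteq> prob_simplex"
    and ge: "c \<le> measure M {\<omega> \<in> space M. (\<chi> i. measure P {a i}) \<in> R (empirical a N (\<lambda>j. X j \<omega>))}"
  shows "c \<le> measure M {\<omega> \<in> space M. simultaneously_implies_guarantee TYPE('k::finite) P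
          (\<lambda>\<epsilon>. uncertainty_set a (R (empirical a N (\<lambda>j. X j \<omega>))) \<epsilon>)}"
proof -
  interpret M: prob_space M by fact
  note ge
  also have "measure M {\<omega> \<in> space M. (\<chi> i. measure P {a i}) \<in> R (empirical a N (\<lambda>j. X j \<omega>))}
    \<le> measure M {\<omega> \<in> space M. simultaneously_implies_guarantee TYPE('k) P
          (\<lambda>\<epsilon>. uncertainty_set a (R (empirical a N (\<lambda>j. X j \<omega>))) \<epsilon>)}"
  proof (rule M.finite_measure_mono)
    show "{\<omega> \<in> space M. (\<chi> i. measure P {a i}) \<in> R (empirical a N (\<lambda>j. X j \<omega>))}
      \<subseteq> {\<omega> \<in> space M. simultaneously_implies_guarantee TYPE('k) P
          (\<lambda>\<epsilon>. uncertainty_set a (R (empirical a N (\<lambda>j. X j \<omega>))) \<epsilon>)}"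
      using guarantee_of_mem_region[OF assms(1-4) _ R] by blast
    show "{\<omega> \<in> space M. simultaneously_implies_guarantee TYPE('k) P
          (\<lambda>\<epsilon>. uncertainty_set a (R (empirical a N (\<lambda>j. X j \<omega>))) \<epsilon>)} \<in> sets M"
      using X by (rule empirical_event_measurable)
  qed
  finally show ?thesis .
qed

theorem theorem4:
  fixes \<alpha> :: real and N :: nat
    and P :: "(real^'d) measure"
    and a :: "'n::finite \<Rightarrow> real^'d"
    and M :: "'w measure" and X :: "nat \<Rightarrow> 'w \<Rightarrow> real^'d"
  defines "ph \<equiv> \<lambda>\<omega>. empirical a N (\<lambda>j. X j \<omega>)"
    and "pstar \<equiv> (\<chi> i. measure P {a i})"
  assumes "0 < \<alpha>" "\<alpha> < 1" and "0 < N"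
    and "prob_space P" and "sets P = sets borel"
    and "inj a" and "measure_support P \<subseteq> range a"
    and "prob_space M"
    and "prob_space.indep_vars M (\<lambda>_. borel) X {..<N}"
    and "\<And>j. j < N \<Longrightarrow> distr M borel (X j) = P"
  shows
    "(measure M {\<omega> \<in> space M. pstar \<in> conf_region_chi \<alpha> N (ph \<omega>)} \<ge> 1 - \<alpha> \<longrightarrow>
      measure M {\<omega> \<in> space M. simultaneously_implies_guarantee TYPE('k::finite) P
          (\<lambda>\<epsilon>. uncertainty_set a (conf_region_chi \<alpha> N (ph \<omega>)) \<epsilon>)} \<ge> 1 - \<alpha>) \<and>
     (measure M {\<omega> \<in> space M. pstar \<in> conf_region_G \<alpha> N (ph \<omega>)} \<ge> 1 - \<alpha> \<longrightarrow>
      measure M {\<omega> \<in> space M. simultaneously_implies_guarantee TYPE('k) P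
          (\<lambda>\<epsilon>. uncertainty_set a (conf_region_G \<alpha> N (ph \<omega>)) \<epsilon>)} \<ge> 1 - \<alpha>) \<and>
     (\<forall>\<omega> \<in> space M. (\<forall>j<N. X j \<omega> \<in> range a) \<longrightarrow> (\<forall>\<epsilon> v. 0 < \<epsilon> \<and> \<epsilon> < 1 \<longrightarrow>
        is_minimum (chi_objective \<alpha> N (ph \<omega>) \<epsilon>) (chi_feasible a v)
          (support_fun (uncertainty_set a (conf_region_chi \<alpha> N (ph \<omega>)) \<epsilon>) v) \<and>
        is_minimum (G_objective \<alpha> N (ph \<omega>) \<epsilon>) (G_feasible a v)
          (support_fun (uncertainty_set a (conf_region_G \<alpha> N (ph \<omega>)) \<epsilon>) v)))"
proof -
  note ps = \<open>prob_space P\<close> \<open>sets P = sets borel\<close> \<open>inj a\<close> \<open>measure_support P \<subseteq> range a\<close> \<open>prob_space M\<close>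
  have "\<forall>j\<in>{..<N}. X j \<in> measurable M borel"
    using \<open>prob_space.indep_vars M (\<lambda>_. borel) X {..<N}\<close>
    unfolding prob_space.indep_vars_def[OF \<open>prob_space M\<close>] by (rule conjunct1)
  then have X: "X j \<in> measurable M borel" if "j < N" for j using that by simp
  have sub: "conf_region_chi \<alpha> N p \<subseteq> prob_simplex" "conf_region_G \<alpha> N p \<subseteq> prob_simplex"
    for p :: "real^'n"
    by (auto simp: conf_region_chi_def conf_region_G_def)
  note prob = guarantee_probability[OF ps X]
  show ?thesis
  proof (intro conjI impI ballI allI)
    fix \<omega> :: 'w and \<epsilon> :: real and v :: "real^'d"
    assume "\<forall>j<N. X j \<omega> \<in> range a" "0 < \<epsilon> \<and> \<epsilon> < 1"
    then have "ph \<omega> \<in> prob_simplex" "0 < \<epsilon>" "\<epsilon> < 1"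
      using \<open>0 < N\<close> \<open>inj a\<close> unfolding ph_def by (simp_all add: empirical_mem_prob_simplex)
    note \<omega> = \<open>0 < \<alpha>\<close> \<open>\<alpha> < 1\<close> \<open>0 < N\<close> this
    show "is_minimum (chi_objective \<alpha> N (ph \<omega>) \<epsilon>) (chi_feasible a v)
        (support_fun (uncertainty_set a (conf_region_chi \<alpha> N (ph \<omega>)) \<epsilon>) v)"
      by (rule chi_support_fun_is_minimum[OF \<omega>])
    show "is_minimum (G_objective \<alpha> N (ph \<omega>) \<epsilon>) (G_feasible a v)
        (support_fun (uncertainty_set a (conf_region_G \<alpha> N (ph \<omega>)) \<epsilon>) v)"
      by (rule G_support_fun_is_minimum[OF \<omega>])
  next
    assume "1 - \<alpha> \<le> measure M {\<omega> \<in> space M. pstar \<in> conf_region_chi \<alpha> N (ph \<omega>)}"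
    then show "1 - \<alpha> \<le> measure M {\<omega> \<in> space M. simultaneously_implies_guarantee TYPE('k) P
          (\<lambda>\<epsilon>. uncertainty_set a (conf_region_chi \<alpha> N (ph \<omega>)) \<epsilon>)}"
      unfolding ph_def pstar_def by (intro prob[where R = "conf_region_chi \<alpha> N"] sub)
  next
    assume "1 - \<alpha> \<le> measure M {\<omega> \<in> space M. pstar \<in> conf_region_G \<alpha> N (ph \<omega>)}"
    then show "1 - \<alpha> \<le> measure M {\<omega> \<in> space M. simultaneously_implies_guarantee TYPE('k) P
          (\<lambda>\<epsilon>. uncertainty_set a (conf_region_G \<alpha> N (ph \<omega>)) \<epsilon>)}"
      unfolding ph_def pstar_def by (intro prob[where R = "conf_region_G \<alpha> N"] sub)
  qed
qed

end
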